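(* Let $a,b>0$, and consider the controlled three-scale system $$\left\{\begin{aligned}& \dot{\mathbf{u}}_{\varepsilon}(s) = -D\mathbf{v}_{\varepsilon}(s) -D\mathbf{p}_{\varepsilon}(s) + \mathbb{H}(\mathbf{u}_{\varepsilon}(s))\alpha(s), && \mathbf{u}_{\varepsilon}(0) = \mathbf{u}_0\in \mathbb{R}^{m}, \\ & \dot{\mathbf{v}}_{\varepsilon}(s) = -a\, D \mathbf{u}_{\varepsilon}(s) + \mathbf{w}_{\varepsilon}(s) + \mathbf{q}_{\varepsilon}(s), && \mathbf{v}_{\varepsilon}(0)=\mathbf{v}_0\in \mathbb{R}^{m}, \\ & \dot{\mathbf{w}}_{\varepsilon}(s) = - b \, D \mathbf{u}_{\varepsilon}(s), && \mathbf{w}_{\varepsilon}(0)=\mathbf{w}_0\in \mathbb{R}^{m}, \\ & \dot{\mathbf{p}}_{\varepsilon}(s) = -\tfrac{1}{\varepsilon}\big[ \mathbf{v}_{\varepsilon}(s)-\mathcal{F}_{0}(\mathbf{u}_{\varepsilon}(s)) - \mathbb{G}(\mathbf{u}_{\varepsilon}(s))\beta(s) +\mathbf{p}_{\varepsilon}(s)\big], && \mathbf{p}_{\varepsilon}(0) = \mathbf{p}_0\in \mathbb{R}^{m},\\ & \dot{\mathbf{q}}_{\varepsilon}(s) = -\tfrac{1}{\varepsilon^{2}}\big[ \mathbf{w}_{\varepsilon}(s)-\mathcal{F}_{1}(\mathbf{u}_{\varepsilon}(s)) - \mathbb{K}(\mathbf{u}_{\varepsilon}(s))\gamma(s)+\mathbf{q}_{\varepsilon}(s)\big],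 && \mathbf{q}_{\varepsilon}(0) = \mathbf{q}_0\in \mathbb{R}^{m}.\end{aligned}\right.\tag{E}$$ For a time horizon $t\in(0,1]$ let $$\mathbf{V}^{\varepsilon}(\mathbf{u}_{0}, \mathbf{v}_{0}, \mathbf{w}_{0}, \mathbf{p}_{0}, \mathbf{q}_{0},t) = \inf \left\{\int_{0}^{t} \ell(\mathbf{u}_{\varepsilon}(s))\,ds + \phi(\mathbf{u}_\varepsilon(t))\right\}\ \text{ subject to (E)},$$ $$\mathbf{V}_{0}(\mathbf{u}_{0},t) = \inf \left\{\int_{0}^{t} \ell(\mathbf{u}(s))\,ds + \phi(\mathbf{u}(t))\right\}$$ subject to $$\dot{\mathbf{u}}(s) + D\big[\mathcal{F}_0(\mathbf{u}(s))+\mathbb{G}(\mathbf{u}(s))\beta(s)\big] = \mathbb{H}(\mathbf{u}(s))\alpha(s),\qquad \mathbf{u}(0) = \mathbf{u}_{0}\in\mathbb{R}^{m}.$$ Then, as $\varepsilon\to0$, the value function $\mathbf{V}^{\varepsilon}$ converges locally uniformly on $(\mathbb{R}^{m})^{5}\times (0,1]$ to the value function $\mathbf{V}_{0}$.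
   Context: $D$ is a fixed $m\times m$ matrix (a spatial discretisation of $\partial_x$; its structure is not relevant). Infima are over measurable controls $\alpha(\cdot),\beta(\cdot),\gamma(\cdot)$ with values in compact convex subsets $\Omega_A,\Omega_B,\Omega_\Gamma$ of finite-dimensional Euclidean spaces, which are sufficiently large. $\mathcal{F}_0,\mathcal{F}_1:\mathbb{R}^m\to\mathbb{R}^m$ are vector-valued functions, and $\mathbb{H},\mathbb{G},\mathbb{K}$ are matrix-valued functions on $\mathbb{R}^m$ of the appropriate sizes; all are locally Lipschitz with at most linear growth. For every $\mathbf{u}$ the matrices $\mathbb{G}(\mathbf{u})$ and $\mathbb{K}(\mathbf{u})$ have full rank. The functions $\ell,\phi:\mathbb{R}^m\to\mathbb{R}$ are bounded and uniformly continuous. Convention for the fast variables: trajectories starting in compact sets remain in compact sets, so the paper assumes without loss of generality that the fast variables $\mathbf{p}_\varepsilon,\mathbf{q}_\varepsilon$ live in the torus $\mathbb{T}^m$ and that all functions are periodic in them. Full rank and sufficiently large control sets are meant to guarantee that, for fixed slow variables $(\mathbf u,\mathbf v,\mathbf w)$, the closed convex hulls of $\{-\mathbf{p}-\mathbf{v}+\mathcal{F}_0(\mathbf{u})+\mathbb{G}(\mathbf{u})\beta:\beta\in\Omega_B\}$ and $\{-\mathbf{q}-\mathbf{w}+\mathcal{F}_1(\mathbf{u})+\mathbb{K}(\mathbf{u})\gamma:\gamma\in\Omega_\Gamma\}$ contain a ball centred at $0$ of positive radius independent of $\mathbf{p},\mathbf{q}\in\mathbb{T}^m$. *)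

theory Defs
  imports "HOL-Analysis.Analysis"
begin

abbreviation locally_lipschitz :: "('a::metric_space \<Rightarrow> 'b::metric_space) \<Rightarrow> bool" where
  "locally_lipschitz f \<equiv> local_lipschitz (UNIV :: real set) UNIV (\<lambda>_. f)"

definition linear_growth :: "('a::real_normed_vector \<Rightarrow> 'b::real_normed_vector) \<Rightarrow> bool" where
  "linear_growth f \<longleftrightarrow> (\<exists>C. \<forall>x. norm (f x) \<le> C * (1 + norm x))"

definition full_rank :: "real^'n^'m \<Rightarrow> bool" where
  "full_rank A \<longleftrightarrow> rank A = min CARD('m) CARD('n)"

definition admissible_control ::
  "real \<Rightarrow> 'a::euclidean_space set \<Rightarrow> (real \<Rightarrow> 'a) \<Rightarrow> bool" where
  "admissible_control t \<Omega> \<alpha> \<longleftrightarrow>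
     \<alpha> \<in> borel_measurable (lebesgue_on {0..t}) \<and> (\<forall>s\<in>{0..t}. \<alpha> s \<in> \<Omega>)"

text \<open>
  The equation \<open>x' = g\<close>, \<open>x 0 = x\<^sub>0\<close> on \<open>[0, t]\<close> in the Caratheodory sense, as usual for
  controls that are merely measurable: \<open>g\<close> is Lebesgue integrable and \<open>x\<close> is its primitive.
  In the systems below \<open>g\<close> is the right-hand side evaluated along the trajectory itself.
\<close>

definition caratheodory ::
  "real \<Rightarrow> (real \<Rightarrow> 'a::euclidean_space) \<Rightarrow> (real \<Rightarrow> 'a) \<Rightarrow> 'a \<Rightarrow> bool" where
  "caratheodory t x g x\<^sub>0 \<longleftrightarrow>
     g absolutely_integrable_on {0..t} \<and> (\<forall>s\<in>{0..t}. x s = x\<^sub>0 + integral {0..s} g)"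

text \<open>
  The fast variables \<open>p\<close>, \<open>q\<close> are taken in \<open>\<real>\<^sup>m\<close> and not in a torus: the right-hand sides
  are linear, hence not periodic, in them. Likewise no size condition is put on the control
  sets: \<open>G u\<close> maps a compact control set to a bounded set, so the convex hull of the fast velocities
  \<open>- p - v + F0 u + G u \<beta>\<close> cannot contain a ball around \<open>0\<close> for all \<open>v \<in> \<real>\<^sup>m\<close>.
\<close>

definition three_scale_solution ::
  "real^'m^'m \<Rightarrow> real \<Rightarrow> real \<Rightarrow> (real^'m \<Rightarrow> real^'m) \<Rightarrow> (real^'m \<Rightarrow> real^'m) \<Rightarrow>
   (real^'m \<Rightarrow> real^'i^'m) \<Rightarrow> (real^'m \<Rightarrow> real^'j^'m) \<Rightarrow> (real^'m \<Rightarrow> real^'k^'m) \<Rightarrow> real \<Rightarrow> real \<Rightarrow>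
   (real \<Rightarrow> real^'i) \<Rightarrow> (real \<Rightarrow> real^'j) \<Rightarrow> (real \<Rightarrow> real^'k) \<Rightarrow>
   (real^'m) \<times> (real^'m) \<times> (real^'m) \<times> (real^'m) \<times> (real^'m) \<Rightarrow>
   (real \<Rightarrow> real^'m) \<Rightarrow> (real \<Rightarrow> real^'m) \<Rightarrow> (real \<Rightarrow> real^'m) \<Rightarrow>
   (real \<Rightarrow> real^'m) \<Rightarrow> (real \<Rightarrow> real^'m) \<Rightarrow> bool" where
  "three_scale_solution D a b F0 F1 H G K \<epsilon> t \<alpha> \<beta> \<gamma> = (\<lambda>(u\<^sub>0, v\<^sub>0, w\<^sub>0, p\<^sub>0, q\<^sub>0) u v w p q.
     caratheodory t u (\<lambda>s. - (D *v v s) - D *v p s + H (u s) *v \<alpha> s) u\<^sub>0 \<and>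
     caratheodory t v (\<lambda>s. - (a *\<^sub>R (D *v u s)) + w s + q s) v\<^sub>0 \<and>
     caratheodory t w (\<lambda>s. - (b *\<^sub>R (D *v u s))) w\<^sub>0 \<and>
     caratheodory t p (\<lambda>s. - ((1 / \<epsilon>) *\<^sub>R (v s - F0 (u s) - G (u s) *v \<beta> s + p s))) p\<^sub>0 \<and>
     caratheodory t q (\<lambda>s. - ((1 / \<epsilon>\<^sup>2) *\<^sub>R (w s - F1 (u s) - K (u s) *v \<gamma> s + q s))) q\<^sub>0)"

definition limit_solution ::
  "real^'m^'m \<Rightarrow> (real^'m \<Rightarrow> real^'m) \<Rightarrow> (real^'m \<Rightarrow> real^'i^'m) \<Rightarrow> (real^'m \<Rightarrow> real^'j^'m) \<Rightarrow>
   real \<Rightarrow> (real \<Rightarrow> real^'i) \<Rightarrow> (real \<Rightarrow> real^'j) \<Rightarrow> real^'m \<Rightarrow> (real \<Rightarrow> real^'m) \<Rightarrow> bool" where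
  "limit_solution D F0 H G t \<alpha> \<beta> u\<^sub>0 u \<longleftrightarrow>
     caratheodory t u (\<lambda>s. H (u s) *v \<alpha> s - D *v (F0 (u s) + G (u s) *v \<beta> s)) u\<^sub>0"

definition cost ::
  "('a \<Rightarrow> real) \<Rightarrow> ('a \<Rightarrow> real) \<Rightarrow> real \<Rightarrow> (real \<Rightarrow> 'a) \<Rightarrow> real" where
  "cost l \<phi> t u = integral {0..t} (\<lambda>s. l (u s)) + \<phi> (u t)"

definition three_scale_value ::
  "real^'m^'m \<Rightarrow> real \<Rightarrow> real \<Rightarrow> (real^'m \<Rightarrow> real^'m) \<Rightarrow> (real^'m \<Rightarrow> real^'m) \<Rightarrow>
   (real^'m \<Rightarrow> real^'i^'m) \<Rightarrow> (real^'m \<Rightarrow> real^'j^'m) \<Rightarrow> (real^'m \<Rightarrow> real^'k^'m) \<Rightarrow>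
   (real^'i) set \<Rightarrow> (real^'j) set \<Rightarrow> (real^'k) set \<Rightarrow> (real^'m \<Rightarrow> real) \<Rightarrow> (real^'m \<Rightarrow> real) \<Rightarrow>
   real \<Rightarrow> (real^'m) \<times> (real^'m) \<times> (real^'m) \<times> (real^'m) \<times> (real^'m) \<Rightarrow> real \<Rightarrow> real" where
  "three_scale_value D a b F0 F1 H G K \<Omega>\<^sub>A \<Omega>\<^sub>B \<Omega>\<^sub>\<Gamma> l \<phi> \<epsilon> z\<^sub>0 t =
     Inf {cost l \<phi> t u | \<alpha> \<beta> \<gamma> u v w p q.
       admissible_control t \<Omega>\<^sub>A \<alpha> \<and> admissible_control t \<Omega>\<^sub>B \<beta> \<and> admissible_control t \<Omega>\<^sub>\<Gamma> \<gamma> \<and>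
       three_scale_solution D a b F0 F1 H G K \<epsilon> t \<alpha> \<beta> \<gamma> z\<^sub>0 u v w p q}"

definition limit_value ::
  "real^'m^'m \<Rightarrow> (real^'m \<Rightarrow> real^'m) \<Rightarrow> (real^'m \<Rightarrow> real^'i^'m) \<Rightarrow> (real^'m \<Rightarrow> real^'j^'m) \<Rightarrow>
   (real^'i) set \<Rightarrow> (real^'j) set \<Rightarrow> (real^'m \<Rightarrow> real) \<Rightarrow> (real^'m \<Rightarrow> real) \<Rightarrow>
   real^'m \<Rightarrow> real \<Rightarrow> real" where
  "limit_value D F0 H G \<Omega>\<^sub>A \<Omega>\<^sub>B l \<phi> u\<^sub>0 t =
     Inf {cost l \<phi> t u | \<alpha> \<beta> u.
       admissible_control t \<Omega>\<^sub>A \<alpha> \<and> admissible_control t \<Omega>\<^sub>B \<beta> \<and>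
       limit_solution D F0 H G t \<alpha> \<beta> u\<^sub>0 u}"

end

theory Submission
  imports Defs
begin

text \<open>
  The fast equations are affine, so no averaging is needed:
  \<open>\<epsilon> p' = F0 u + G u \<beta> - v - p\<close> gives \<open>v + p = F0 u + G u \<beta> - \<epsilon> p'\<close>, hence
  \<open>(u - \<epsilon> D p)' = H u \<alpha> - D (F0 u + G u \<beta>)\<close>, which is the limit equation up to the shift \<open>\<epsilon> D p\<close>.
  In the same way \<open>(v + \<epsilon>\<^sup>2 q)' = - a D u + F1 u + K u \<gamma>\<close>. A maximum principle for the relaxation
  equations bounds \<open>p\<close> and \<open>q\<close> by the running suprema of \<open>u, v, w\<close>, and a Gronwall argument then bounds
  everything uniformly in \<open>\<epsilon>\<close> and in the controls. So for the same \<open>\<alpha>\<close> and \<open>\<beta>\<close>, whatever \<open>\<gamma>\<close> is, the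
  two \<open>u\<close>-trajectories differ by \<open>O(\<epsilon>)\<close>, and with global existence for both systems the two infima are close.
\<close>

text \<open>Gronwall cannot be applied to the five equations as they stand: their right-hand sides
  are of order \<open>1 / \<epsilon>\<^sup>2\<close>, and the estimate would be exponential in that
  size. The drifts of the slow combinations contain only \<open>u\<close> and the controls, with
  constants free of \<epsilon>. The price is the way back from the combinations to \<open>u\<close>
  and \<open>v\<close>: it costs \<open>\<epsilon> *\<^sub>R (D *v p s)\<close> and
  \<open>\<epsilon>\<^sup>2 *\<^sub>R q s\<close>, and the fast variables are controlled by the past
  of the slow ones, not by their present value. Hence a Gronwall inequality with a running supremum.
  Its coefficients are \<open>\<epsilon> * C\<^sup>2\<close> and
  \<open>\<epsilon>\<^sup>2 * C\<close>; each is at most 1/8 for small \<epsilon>, together the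
  tolerated quarter. The data are only locally Lipschitz, so the uniform bound has to precede the
  comparison: it provides one ball for all trajectories, hence one Lipschitz constant, before
  \<epsilon> is chosen. In the comparison \<open>v\<close>, \<open>w\<close>, \<open>q\<close> and
  \<gamma> are visible only through the bound on \<open>p\<close>.\<close>

section \<open>Exponential weights and a Gronwall inequality\<close>

lemma exp_mult_integral:
  fixes c s :: real
  assumes "c > 0" "s \<ge> 0"
  shows "((\<lambda>r. exp (c * r)) has_integral (exp (c * s) - 1) / c) {0..s}"
proof -
  have "((\<lambda>r. exp (c * r)) has_integral exp (c * s) / c - exp (c * 0) / c) {0..s}"
    using assms
    by (intro fundamental_theorem_of_calculus)
      (auto intro!: derivative_eq_intros simp flip: has_real_derivative_iff_has_vector_derivative)
  then show ?thesis
    by (simp add: diff_divide_distrib)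
qed

text \<open>Integrating a function of exponential rate \<open>c\<close> gains a factor
  \<open>1 / c\<close>. This is what makes weighted suprema work: rate \<open>4 * B\<close> turns
  the factor \<open>B\<close> into 1/4 in the Gronwall inequality, rate \<open>2 * K\<close> turns
  the Lipschitz constant \<open>K\<close> into 1/2 in the Picard iteration.\<close>

lemma integral_le_exp:
  fixes c s :: real
  assumes "c > 0" "s \<ge> 0" "m \<ge> 0" "g integrable_on {0..s}"
    and "\<And>r. r \<in> {0..s} \<Longrightarrow> g r \<le> m * exp (c * r)"
  shows "integral {0..s} g \<le> m * exp (c * s) / c"
proof -
  have int: "((\<lambda>r. m * exp (c * r)) has_integral m * ((exp (c * s) - 1) / c)) {0..s}"
    using exp_mult_integral[OF assms(1,2)] by (rule has_integral_mult_right)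
  have "integral {0..s} g \<le> integral {0..s} (\<lambda>r. m * exp (c * r))"
    using assms int by (intro integral_le) auto
  also have "\<dots> = m * ((exp (c * s) - 1) / c)"
    using int by (rule integral_unique)
  also have "\<dots> \<le> m * exp (c * s) / c"
    using assms by (simp add: field_simps)
  finally show ?thesis .
qed

text \<open>
  A Gronwall inequality that tolerates a quarter of the running supremum on the right. The
  weighted supremum of \<open>exp (- 4 B s) * g s\<close> absorbs both that term and the integral.
\<close>

lemma gronwall_running_bound:
  fixes g :: "real \<Rightarrow> real"
  assumes cont: "continuous_on {0..t} g" and "B > 0" "A \<ge> 0"
    and nonneg: "\<And>s. s \<in> {0..t} \<Longrightarrow> 0 \<le> g s"
    and step: "\<And>s N. s \<in> {0..t} \<Longrightarrow> (\<And>r. r \<in> {0..s} \<Longrightarrow> g r \<le> N) \<Longrightarrow>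
      g s \<le> A + N / 4 + B * integral {0..s} g"
    and s: "s \<in> {0..t}"
  shows "g s \<le> 2 * A * exp (4 * B * t)"
proof -
  have "\<exists>x\<in>{0..t}. \<forall>r\<in>{0..t}. exp (- (4 * B * r)) * g r \<le> exp (- (4 * B * x)) * g x"
    using s cont by (intro continuous_attains_sup) (auto intro!: continuous_intros)
  then obtain x where x: "x \<in> {0..t}"
    and max: "\<And>r. r \<in> {0..t} \<Longrightarrow> exp (- (4 * B * r)) * g r \<le> exp (- (4 * B * x)) * g x"
    by blast
  define m where "m = exp (- (4 * B * x)) * g x"
  have m: "0 \<le> m" using nonneg[OF x] by (simp add: m_def)
  have g_le: "g r \<le> m * exp (4 * B * r)" if "r \<in> {0..t}" for r
    using max[OF that] unfolding m_def[symmetric] by (simp add: exp_minus field_simps)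
  have le: "m * exp (4 * B * r) \<le> m * exp (4 * B * r')" if "r \<le> r'" for r r'
    using that m \<open>B > 0\<close> by (intro mult_left_mono) auto
  \<comment> \<open>The right-hand side equals \<open>g x\<close>, so \<open>g x\<close> is the
    running supremum up to \<open>x\<close>. With it in the role of \<open>N\<close>, that term and
    the integral each contribute a quarter of \<open>g x\<close>.\<close>
  have "g r \<le> m * exp (4 * B * x)" if "r \<in> {0..x}" for r
    using order_trans[OF g_le le[of r x]] that x by auto
  then have "g x \<le> A + m * exp (4 * B * x) / 4 + B * integral {0..x} g"
    using x by (intro step)
  also have "B * integral {0..x} g \<le> B * (m * exp (4 * B * x) / (4 * B))"
    using \<open>B > 0\<close> x m g_le cont
    by (intro mult_left_mono integral_le_exp)
      (auto intro!: integrable_continuous_real intro: continuous_on_subset)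
  also have "\<dots> = m * exp (4 * B * x) / 4"
    using \<open>B > 0\<close> by simp
  finally have "g x \<le> A + m * exp (4 * B * x) / 2"
    by simp
  moreover have "m * exp (4 * B * x) = g x"
    by (simp add: m_def exp_minus)
  ultimately have "g x \<le> 2 * A"
    by simp
  \<comment> \<open>The weight is at most 1, so the bound at the single point \<open>x\<close>
    becomes a bound on the weighted supremum, and from there reaches every \<open>s\<close>.\<close>
  moreover have "m \<le> g x"
    using x \<open>B > 0\<close> nonneg[OF x] by (simp add: m_def mult_left_le_one_le)
  ultimately have "m \<le> 2 * A" by simp
  have "g s \<le> m * exp (4 * B * t)"
    using g_le[OF s] le[of s t] s by auto
  also have "\<dots> \<le> 2 * A * exp (4 * B * t)"
    using \<open>m \<le> 2 * A\<close> by simp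
  finally show ?thesis .
qed

section \<open>Caratheodory solutions\<close>

lemma caratheodory_integrable:
  assumes "caratheodory t x g x\<^sub>0" "s \<le> t"
  shows "g integrable_on {0..s}" "g absolutely_integrable_on {0..s}"
proof -
  show "g absolutely_integrable_on {0..s}"
    using assms by (auto simp: caratheodory_def intro: absolutely_integrable_on_subinterval)
  then show "g integrable_on {0..s}"
    by (rule set_lebesgue_integral_eq_integral(1))
qed

lemma caratheodory_initial:
  assumes "caratheodory t x g x\<^sub>0" "0 \<le> t"
  shows "x 0 = x\<^sub>0"
  using assms by (simp add: caratheodory_def)

lemma caratheodory_continuous:
  assumes "caratheodory t x g x\<^sub>0"
  shows "continuous_on {0..t} x"
proof -
  have "continuous_on {0..t} (\<lambda>s. x\<^sub>0 + integral {0..s} g)"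
    using caratheodory_integrable[OF assms order_refl]
    by (intro continuous_intros indefinite_integral_continuous_1)
  then show ?thesis
    by (rule continuous_on_eq) (use assms in \<open>simp add: caratheodory_def\<close>)
qed

lemma caratheodory_subinterval:
  assumes "caratheodory t x g x\<^sub>0" "s \<le> t"
  shows "caratheodory s x g x\<^sub>0"
  using assms caratheodory_integrable[OF assms] by (simp add: caratheodory_def)

text \<open>Working with the integral equation avoids differentiating trajectories. Together with
  sums this yields the slow combinations, and with coordinate projections it splits a solution on a
  product space into its components.\<close>

lemma caratheodory_bounded_linear:
  assumes "caratheodory t x g x\<^sub>0" "bounded_linear h"
  shows "caratheodory t (\<lambda>s. h (x s)) (\<lambda>s. h (g s)) (h x\<^sub>0)"
proof -
  interpret bounded_linear h by fact
  have "integral {0..s} (\<lambda>s. h (g s)) = h (integral {0..s} g)" if "s \<le> t" for s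
    using integral_linear[OF caratheodory_integrable(1)[OF assms(1) that] assms(2)]
    by (simp add: o_def)
  then show ?thesis
    using assms(1) absolutely_integrable_linear[OF caratheodory_integrable(2)[OF assms(1) order_refl] assms(2)]
    by (auto simp: caratheodory_def add o_def)
qed

lemma caratheodory_add:
  assumes "caratheodory t x g x\<^sub>0" "caratheodory t y h y\<^sub>0"
  shows "caratheodory t (\<lambda>s. x s + y s) (\<lambda>s. g s + h s) (x\<^sub>0 + y\<^sub>0)"
proof -
  have "integral {0..s} (\<lambda>s. g s + h s) = integral {0..s} g + integral {0..s} h" if "s \<le> t" for s
    using assms that by (intro integral_add caratheodory_integrable)
  then show ?thesis
    using assms by (auto simp: caratheodory_def)
qed

lemma caratheodory_eq:
  assumes "caratheodory t x g x\<^sub>0" "\<And>s. s \<in> {0..t} \<Longrightarrow> g s = h s"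
  shows "caratheodory t x h x\<^sub>0"
proof -
  have "integral {0..s} g = integral {0..s} h" if "s \<le> t" for s
    using assms that by (intro integral_cong) auto
  moreover have "h absolutely_integrable_on {0..t}"
    using assms set_integrable_cong[of lebesgue lebesgue "{0..t}" "{0..t}" g h]
    by (auto simp: caratheodory_def)
  ultimately show ?thesis
    using assms by (auto simp: caratheodory_def)
qed

lemma caratheodory_norm_le:
  assumes "caratheodory t x g x\<^sub>0" "k integrable_on {0..t}" "s \<in> {0..t}"
    and "\<And>r. r \<in> {0..t} \<Longrightarrow> norm (g r) \<le> k r"
  shows "norm (x s) \<le> norm x\<^sub>0 + integral {0..s} k"
proof -
  have "norm (integral {0..s} g) \<le> integral {0..s} k"
    using assms
    by (intro integral_norm_bound_integral)
      (auto intro: caratheodory_integrable integrable_on_subinterval)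
  then show ?thesis
    using assms norm_triangle_ineq[of x\<^sub>0 "integral {0..s} g"] by (auto simp: caratheodory_def)
qed

text \<open>
  Maximum principle for \<open>p' = - c (p - h)\<close>. Since \<open>p\<close> is only absolutely continuous, the derivative at the
  maximum point \<open>x\<close> of \<open>norm \<circ> p\<close> is replaced by the increment of \<open>e \<bullet> p\<close> over a short interval ending at
  \<open>x\<close>, where \<open>e\<close> is the direction of \<open>p x\<close>.
\<close>

lemma relaxation_bound:
  fixes p h :: "real \<Rightarrow> 'a::euclidean_space"
  assumes sol: "caratheodory t p (\<lambda>s. - (c *\<^sub>R (p s - h s))) p\<^sub>0" and "c > 0"
    and h: "\<And>s. s \<in> {0..t} \<Longrightarrow> norm (h s) \<le> M" and "norm p\<^sub>0 \<le> M" and s: "s \<in> {0..t}"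
  shows "norm (p s) \<le> M"
proof (rule ccontr)
  assume "\<not> norm (p s) \<le> M"
  have cont: "continuous_on {0..t} p"
    by (rule caratheodory_continuous) fact
  then have "\<exists>x\<in>{0..t}. \<forall>r\<in>{0..t}. norm (p r) \<le> norm (p x)"
    using s by (intro continuous_attains_sup) (auto intro!: continuous_intros)
  then obtain x where x: "x \<in> {0..t}" and max: "\<And>r. r \<in> {0..t} \<Longrightarrow> norm (p r) \<le> norm (p x)"
    by blast
  have M: "M < norm (p x)"
    using max[OF s] \<open>\<not> norm (p s) \<le> M\<close> by simp
  have "0 \<le> M" using \<open>norm p\<^sub>0 \<le> M\<close> norm_ge_zero[of p\<^sub>0] by linarith
  define e where "e = sgn (p x)"
  have "p x \<noteq> 0" using M \<open>0 \<le> M\<close> by auto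
  then have e: "norm e = 1" "e \<bullet> p x = norm (p x)"
    by (simp_all add: e_def norm_sgn sgn_div_norm dot_square_norm power2_eq_square)
  have cont': "continuous_on {0..t} (\<lambda>r. e \<bullet> p r)"
    by (intro continuous_intros cont)
  \<comment> \<open>Half of the gap: \<open>e \<bullet> p x\<close> is
    \<open>M + 2 * \<eta>\<close>, so as long as \<open>e \<bullet> p\<close> moves by less than
    \<eta> it stays \<eta> above \<open>e \<bullet> h\<close>.\<close>
  define \<eta> where "\<eta> = (norm (p x) - M) / 2"
  have \<eta>: "0 < \<eta>" using M by (simp add: \<eta>_def)
  obtain d where d: "d > 0" "\<And>r. r \<in> {0..t} \<Longrightarrow> dist r x < d \<Longrightarrow> dist (e \<bullet> p r) (e \<bullet> p x) < \<eta>"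
    using cont' x \<eta> unfolding continuous_on_iff by blast
  \<comment> \<open>The initial value obeys the bound, so the violation occurs later and there is
    room for an interval to the left of \<open>x\<close>.\<close>
  have "x \<noteq> 0"
    using M \<open>norm p\<^sub>0 \<le> M\<close> caratheodory_initial[OF sol] s by auto
  define y where "y = max 0 (x - d / 2)"
  have y: "0 \<le> y" "y < x" "x - d < y"
    using x \<open>x \<noteq> 0\<close> \<open>d > 0\<close> by (auto simp: y_def)
  let ?g = "\<lambda>s. - (c *\<^sub>R (p s - h s))"
  have int: "?g integrable_on {0..x}"
    by (rule caratheodory_integrable[OF sol]) (use x in auto)
  have int': "?g integrable_on {y..x}"
    by (rule integrable_on_subinterval[OF int]) (use y in auto)
  have "p x - p y = integral {0..x} ?g - integral {0..y} ?g"
    using sol x y by (auto simp: caratheodory_def)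
  also have "\<dots> = integral {y..x} ?g"
    using Henstock_Kurzweil_Integration.integral_combine[OF y(1) less_imp_le[OF y(2)] int] by (simp add: algebra_simps)
  finally have "e \<bullet> p x - e \<bullet> p y = e \<bullet> integral {y..x} ?g"
    unfolding inner_diff_right[symmetric] by (rule arg_cong)
  also have "\<dots> = integral {y..x} (\<lambda>r. e \<bullet> ?g r)"
    using integral_linear[OF int' bounded_linear_inner_right[of e]]
    unfolding o_def by (rule sym)
  also have "\<dots> \<le> integral {y..x} (\<lambda>r. - (c * \<eta>))"
  proof (rule integral_le)
    show "(\<lambda>r. e \<bullet> ?g r) integrable_on {y..x}"
      using integrable_linear[OF int' bounded_linear_inner_right[of e]]
      unfolding o_def .
    fix r assume r: "r \<in> {y..x}"
    then have rt: "r \<in> {0..t}" using x y by auto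
    have "\<bar>e \<bullet> p r - e \<bullet> p x\<bar> < \<eta>"
      using d(2)[OF rt] r y by (auto simp: dist_real_def)
    then have "M + \<eta> \<le> e \<bullet> p r"
      using abs_ge_minus_self[of "e \<bullet> p r - e \<bullet> p x"] e(2) by (simp add: \<eta>_def field_simps)
    moreover have "e \<bullet> h r \<le> M"
      using norm_cauchy_schwarz[of e "h r"] h[OF rt] e by simp
    ultimately have "\<eta> \<le> e \<bullet> (p r - h r)"
      by (simp add: inner_diff_right)
    then show "e \<bullet> ?g r \<le> - (c * \<eta>)"
      using \<open>c > 0\<close> by simp
  qed auto
  also have "\<dots> < 0" using y \<open>c > 0\<close> \<eta> by (simp add: mult_pos_pos)
  \<comment> \<open>\<open>e \<bullet> p\<close> strictly decreases from \<open>y\<close> to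
    \<open>x\<close>; Cauchy-Schwarz at \<open>y\<close> and equality at \<open>x\<close> turn this
    into a larger norm at \<open>y\<close>.\<close>
  finally have "norm (p x) < norm (p y)"
    using e norm_cauchy_schwarz[of e "p y"] by simp
  then show False using max[of y] x y by simp
qed

text \<open>
  Banach's fixed point theorem for \<open>y s = exp (- 2 K s) *\<^sub>R x s\<close>: with this weight the Picard operator has
  Lipschitz constant \<open>1 / 2\<close> on the whole interval.
\<close>

lemma caratheodory_exists_lipschitz:
  fixes f :: "real \<Rightarrow> 'a::euclidean_space \<Rightarrow> 'a"
  assumes "0 \<le> t" "0 < K"
    and int: "\<And>x. continuous_on {0..t} x \<Longrightarrow> (\<lambda>s. f s (x s)) absolutely_integrable_on {0..t}"
    and lip: "\<And>s x y. s \<in> {0..t} \<Longrightarrow> norm (f s x - f s y) \<le> K * norm (x - y)"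
  shows "\<exists>x. caratheodory t x (\<lambda>s. f s (x s)) x\<^sub>0"
proof -
  define F where "F y r = f r (exp (2 * K * r) *\<^sub>R apply_bcontfun y r)" for y r
  define \<Phi> where "\<Phi> y s = exp (- (2 * K * s)) *\<^sub>R (x\<^sub>0 + integral {0..s} (F y))" for y s
  have F_abs: "F y absolutely_integrable_on {0..t}" for y
    unfolding F_def by (intro int continuous_intros) auto
  have F: "F y integrable_on {0..s}" if "s \<in> {0..t}" for y s
    using that set_lebesgue_integral_eq_integral(1)[OF F_abs]
    by (auto intro: integrable_on_subinterval[where S = "{0..t}"])
  have "continuous_on {0..t} (\<Phi> y)" for y
    unfolding \<Phi>_def using F[of t] \<open>0 \<le> t\<close>
    by (intro continuous_intros indefinite_integral_continuous_1) auto
  \<comment> \<open>The complete space is that of bounded continuous functions on the whole line;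
    \<open>clamp\<close> extends a function on \<open>{0..t}\<close> by its boundary values, so that
    the Picard iterates belong to it.\<close>
  then have "\<exists>z. \<forall>s. apply_bcontfun z s = \<Phi> y (clamp 0 t s)" for y
    using continuous_on_cbox_bcontfunE[of 0 t "\<Phi> y"] unfolding cbox_interval by metis
  then obtain T where T: "\<And>y s. apply_bcontfun (T y) s = \<Phi> y (clamp 0 t s)"
    by metis
  have clamp: "clamp 0 t s \<in> {0..t}" for s
    using clamp_in_interval[of 0 t s] \<open>0 \<le> t\<close> by (simp add: cbox_interval)
  have "dist (T y) (T z) \<le> 1 / 2 * dist y z" for y z
  proof (rule dist_bound)
    fix s0
    define s where "s = clamp 0 t s0"
    have s: "s \<in> {0..t}" using clamp by (simp add: s_def)
    have "norm (F y r - F z r) \<le> (K * dist y z) * exp (2 * K * r)" if "r \<in> {0..s}" for r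
    proof -
      have "norm (F y r - F z r) \<le> K * norm (exp (2 * K * r) *\<^sub>R (y r - z r))"
        unfolding F_def scaleR_diff_right using that s by (intro lip) auto
      also have "\<dots> = K * exp (2 * K * r) * dist (y r) (z r)"
        by (simp add: dist_norm)
      also have "\<dots> \<le> K * exp (2 * K * r) * dist y z"
        using \<open>0 < K\<close> by (intro mult_left_mono dist_bounded) auto
      finally show ?thesis by (simp add: mult_ac)
    qed note Fdiff = this
    have "norm (integral {0..s} (F y) - integral {0..s} (F z)) = norm (integral {0..s} (\<lambda>r. F y r - F z r))"
      using F[OF s] by (simp add: integral_diff)
    also have "\<dots> \<le> integral {0..s} (\<lambda>r. (K * dist y z) * exp (2 * K * r))"
      using F[OF s] Fdiff by (intro integral_norm_bound_integral integrable_diff)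
       (auto intro!: integrable_continuous_real continuous_intros)
    also have "\<dots> \<le> (K * dist y z) * exp (2 * K * s) / (2 * K)"
      using \<open>0 < K\<close> s
      by (intro integral_le_exp) (auto intro!: integrable_continuous_real continuous_intros)
    finally have *: "norm (integral {0..s} (F y) - integral {0..s} (F z)) \<le> 1 / 2 * dist y z * exp (2 * K * s)"
      using \<open>0 < K\<close> by simp
    have "dist (T y s0) (T z s0) = exp (- (2 * K * s)) * norm (integral {0..s} (F y) - integral {0..s} (F z))"
      by (simp add: T \<Phi>_def s_def dist_norm flip: scaleR_diff_right)
    also have "\<dots> \<le> exp (- (2 * K * s)) * (1 / 2 * dist y z * exp (2 * K * s))"
      using * by (intro mult_left_mono) auto
    also have "\<dots> = 1 / 2 * dist y z" by (simp add: exp_minus)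
    finally show "dist (T y s0) (T z s0) \<le> 1 / 2 * dist y z" .
  qed
  then have "\<exists>!y. T y = y"
    by (intro banach_fix_type[of "1/2"]) auto
  then obtain y where y: "T y = y" by blast
  define x where "x s = exp (2 * K * s) *\<^sub>R apply_bcontfun y s" for s
  have "x s = x\<^sub>0 + integral {0..s} (\<lambda>s. f s (x s))" if "s \<in> {0..t}" for s
  proof -
    have "apply_bcontfun y s = \<Phi> y s"
      using T[of y s] y that by (simp add: clamp_cancel_cbox cbox_interval)
    then have "x s = x\<^sub>0 + integral {0..s} (F y)"
      by (simp add: x_def \<Phi>_def exp_minus)
    then show ?thesis by (simp add: F_def[abs_def] x_def)
  qed
  moreover have "(\<lambda>s. f s (x s)) absolutely_integrable_on {0..t}"
    using F_abs[of y] by (simp add: F_def[abs_def] x_def)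
  ultimately show ?thesis
    unfolding caratheodory_def by blast
qed

section \<open>Controlled vector fields\<close>

lemma bounded_bilinear_matrix_vector_mult:
  "bounded_bilinear ((*v) :: real^'n^'m \<Rightarrow> real^'n \<Rightarrow> real^'m)"
  unfolding bilinear_conv_bounded_bilinear[symmetric] bilinear_def
  by (auto intro!: linearI simp: algebra_simps matrix_vector_mult_add_rdistrib matrix_vector_right_distrib
      scaleR_matrix_vector_assoc matrix_vector_mult_scaleR)

text \<open>Each clause has its purpose: joint continuity gives measurability along a measurable
  control, linear growth prevents blow-up, and Lipschitz constants on balls allow existence and
  comparison. The constants are uniform over \<Omega>, so no later estimate depends on the chosen
  control.\<close>

definition control_field ::
  "'c::euclidean_space set \<Rightarrow> ('c \<Rightarrow> 'a::euclidean_space \<Rightarrow> 'b::euclidean_space) \<Rightarrow> bool" where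
  "control_field \<Omega> f \<longleftrightarrow>
     continuous_on UNIV (\<lambda>z. f (fst z) (snd z)) \<and>
     (\<exists>C. \<forall>c\<in>\<Omega>. \<forall>x. norm (f c x) \<le> C * (1 + norm x)) \<and>
     (\<forall>R. \<exists>L. \<forall>c\<in>\<Omega>. \<forall>x\<in>cball 0 R. \<forall>y\<in>cball 0 R. norm (f c x - f c y) \<le> L * norm (x - y))"

lemma control_field_growthE:
  assumes "control_field \<Omega> f"
  obtains C where "C > 0" "\<And>c x. c \<in> \<Omega> \<Longrightarrow> norm (f c x) \<le> C * (1 + norm x)"
proof -
  obtain C where C: "\<And>c x. c \<in> \<Omega> \<Longrightarrow> norm (f c x) \<le> C * (1 + norm x)"
    using assms unfolding control_field_def by blast
  show ?thesis
  \<comment> \<open>The definition leaves the sign of the constant open; a strictly positive one can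
    serve as a Gronwall rate.\<close>
  proof (rule that[of "\<bar>C\<bar> + 1"])
    fix c and x :: 'b assume c: "c \<in> \<Omega>"
    have "C * (1 + norm x) \<le> (\<bar>C\<bar> + 1) * (1 + norm x)"
      by (intro mult_right_mono) auto
    with C[OF c] show "norm (f c x) \<le> (\<bar>C\<bar> + 1) * (1 + norm x)"
      by (rule order_trans)
  qed simp
qed

lemma control_field_lipschitzE:
  assumes "control_field \<Omega> f"
  obtains L where "L > 0"
    "\<And>c x y. c \<in> \<Omega> \<Longrightarrow> norm x \<le> R \<Longrightarrow> norm y \<le> R \<Longrightarrow> norm (f c x - f c y) \<le> L * norm (x - y)"
proof -
  obtain L where L: "\<And>c x y. c \<in> \<Omega> \<Longrightarrow> norm x \<le> R \<Longrightarrow> norm y \<le> R \<Longrightarrow>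
      norm (f c x - f c y) \<le> L * norm (x - y)"
    using assms unfolding control_field_def Ball_def mem_cball_0 by blast
  show ?thesis
  proof (rule that[of "\<bar>L\<bar> + 1"])
    fix c and x y :: 'b assume *: "c \<in> \<Omega>" "norm x \<le> R" "norm y \<le> R"
    have "L * norm (x - y) \<le> (\<bar>L\<bar> + 1) * norm (x - y)"
      by (intro mult_right_mono) auto
    with L[OF *] show "norm (f c x - f c y) \<le> (\<bar>L\<bar> + 1) * norm (x - y)"
      by (rule order_trans)
  qed simp
qed

lemma control_fieldI:
  assumes "continuous_on UNIV (\<lambda>z. f (fst z) (snd z))"
    and "\<And>c x. c \<in> \<Omega> \<Longrightarrow> norm (f c x) \<le> C * (1 + norm x)"
    and "\<And>R. \<exists>L. \<forall>c\<in>\<Omega>. \<forall>x y. norm x \<le> R \<longrightarrow> norm y \<le> R \<longrightarrow> norm (f c x - f c y) \<le> L * norm (x - y)"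
  shows "control_field \<Omega> f"
  unfolding control_field_def Ball_def mem_cball_0 using assms by blast

lemma control_field_continuous:
  assumes "control_field \<Omega> f"
  shows "continuous_on UNIV (\<lambda>z. f (fst z) (snd z))"
  using assms by (simp add: control_field_def)

lemma locally_lipschitz_on_cball:
  fixes F :: "'a::euclidean_space \<Rightarrow> 'b::euclidean_space"
  assumes "locally_lipschitz F"
  obtains L where "\<And>x y. norm x \<le> R \<Longrightarrow> norm y \<le> R \<Longrightarrow> norm (F x - F y) \<le> L * norm (x - y)"
proof -
  have "local_lipschitz {0::real} (cball 0 R) (\<lambda>_. F)"
    using assms by (rule local_lipschitz_subset) auto
  then obtain L where "L-lipschitz_on (cball 0 R) F"
    by (rule local_lipschitz_compact_implies_lipschitz) auto
  then show ?thesis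
    by (intro that[of L]) (auto intro: lipschitz_on_normD)
qed

section \<open>Building the fields of both systems from their coefficients\<close>

text \<open>\<open>g\<close> is meant to read one control off a tuple of controls. Its boundedness
  on \<Omega>, which comes from compact control sets, converts the growth and Lipschitz constants of
  \<open>H\<close> into constants uniform in the control.\<close>

lemma control_field_mult:
  fixes H :: "'a::euclidean_space \<Rightarrow> real^'n^'m" and g :: "'c::euclidean_space \<Rightarrow> real^'n"
  assumes H: "locally_lipschitz H" "linear_growth H"
    and g: "continuous_on UNIV g" "bounded (g ` \<Omega>)"
  shows "control_field \<Omega> (\<lambda>c x. H x *v g c)"
proof -
  interpret bounded_bilinear "(*v) :: real^'n^'m \<Rightarrow> real^'n \<Rightarrow> real^'m"
    by (rule bounded_bilinear_matrix_vector_mult)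
  obtain K where K: "K > 0" "\<And>A x. norm (A *v x :: real^'m) \<le> norm A * norm (x :: real^'n) * K"
    using pos_bounded by blast
  obtain M where M: "M > 0" "\<And>c. c \<in> \<Omega> \<Longrightarrow> norm (g c) \<le> M"
    using g(2) unfolding bounded_pos by auto
  have le: "norm (A *v g c) \<le> N * (M * K)" if "c \<in> \<Omega>" "norm A \<le> N" for c N and A :: "real^'n^'m"
  proof -
    have "0 \<le> N" using norm_ge_zero[of A] that by linarith
    then have "norm A * norm (g c) * K \<le> N * M * K"
      using that M K by (intro mult_right_mono mult_mono) auto
    then show ?thesis
      using K(2)[of A "g c"] by (simp add: mult.assoc)
  qed
  obtain C where C: "\<And>x. norm (H x) \<le> C * (1 + norm x)"
    using H(2) unfolding linear_growth_def by blast
  show ?thesis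
  proof (rule control_fieldI)
    have "continuous_on UNIV H"
      using local_lipschitz_continuous_on[OF H(1)] by simp
    then show "continuous_on UNIV (\<lambda>z. H (snd z) *v g (fst z))"
      using g(1)
      by (intro continuous_on continuous_on_compose2[of UNIV H UNIV snd]
          continuous_on_compose2[of UNIV g UNIV fst]) (auto intro: continuous_intros)
    show "norm (H x *v g c) \<le> (C * (M * K)) * (1 + norm x)" if "c \<in> \<Omega>" for c x
      using le[OF that C] by (simp add: mult_ac)
    show "\<exists>L. \<forall>c\<in>\<Omega>. \<forall>x y. norm x \<le> R \<longrightarrow> norm y \<le> R \<longrightarrow>
      norm (H x *v g c - H y *v g c) \<le> L * norm (x - y)" for R
    proof -
      obtain L where L: "\<And>x y. norm x \<le> R \<Longrightarrow> norm y \<le> R \<Longrightarrow> norm (H x - H y) \<le> L * norm (x - y)"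
        using locally_lipschitz_on_cball[OF H(1)] by blast
      have "norm (H x *v g c - H y *v g c) \<le> (L * (M * K)) * norm (x - y)"
        if "c \<in> \<Omega>" "norm x \<le> R" "norm y \<le> R" for c x y
        using le[OF that(1) L[OF that(2,3)]] by (simp add: diff_left mult_ac)
      then show ?thesis by blast
    qed
  qed
qed

lemma control_field_state:
  assumes "locally_lipschitz F" "linear_growth F"
  shows "control_field \<Omega> (\<lambda>_. F)"
proof -
  obtain C where C: "\<And>x. norm (F x) \<le> C * (1 + norm x)"
    using assms unfolding linear_growth_def by blast
  have "continuous_on UNIV F"
    using local_lipschitz_continuous_on[OF assms(1)] by simp
  then have "continuous_on UNIV (\<lambda>z. F (snd z))"
    by (rule continuous_on_compose2[OF _ continuous_on_snd]) (auto intro: continuous_intros)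
  then show ?thesis
    using C locally_lipschitz_on_cball[OF assms(1)]
    by (intro control_fieldI) blast+
qed

text \<open>With \<open>k\<close> a coordinate projection this lifts a field depending on
  \<open>u\<close> alone to the product state space. \<open>k\<close> sends the ball of radius
  \<open>R\<close> into that of radius \<open>R * B\<close>, where the Lipschitz constant is
  taken.\<close>

lemma control_field_linear_state:
  assumes "control_field \<Omega> f" "bounded_linear k"
  shows "control_field \<Omega> (\<lambda>c x. f c (k x))"
proof -
  interpret k: bounded_linear k by fact
  obtain B where B: "B > 0" "\<And>x. norm (k x) \<le> norm x * B"
    using k.pos_bounded by blast
  obtain C where C: "C > 0" "\<And>c x. c \<in> \<Omega> \<Longrightarrow> norm (f c x) \<le> C * (1 + norm x)"
    using control_field_growthE[OF assms(1)] by blast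
  show ?thesis
  proof (rule control_fieldI)
    show "continuous_on UNIV (\<lambda>z. f (fst z) (k (snd z)))"
      using continuous_on_compose2[OF control_field_continuous[OF assms(1)], of UNIV "\<lambda>z. (fst z, k (snd z))"]
      by (simp add: continuous_on_Pair continuous_on_fst continuous_on_snd k.continuous_on)
    show "norm (f c (k x)) \<le> (C * (1 + B)) * (1 + norm x)" if "c \<in> \<Omega>" for c x
    proof -
      have "1 + norm (k x) \<le> (1 + B) * (1 + norm x)"
        using B(2)[of x] \<open>B > 0\<close> by (simp add: algebra_simps add_increasing)
      then have "C * (1 + norm (k x)) \<le> C * ((1 + B) * (1 + norm x))"
        using \<open>C > 0\<close> by (intro mult_left_mono) auto
      then show ?thesis
        using C(2)[OF that, of "k x"] by (simp add: mult.assoc)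
    qed
    show "\<exists>L. \<forall>c\<in>\<Omega>. \<forall>x y. norm x \<le> R \<longrightarrow> norm y \<le> R \<longrightarrow>
      norm (f c (k x) - f c (k y)) \<le> L * norm (x - y)" for R
    proof -
      obtain L where L: "L > 0" "\<And>c x y. c \<in> \<Omega> \<Longrightarrow> norm x \<le> R * B \<Longrightarrow> norm y \<le> R * B \<Longrightarrow>
          norm (f c x - f c y) \<le> L * norm (x - y)"
        using control_field_lipschitzE[OF assms(1)] by blast
      have "norm (f c (k x) - f c (k y)) \<le> (L * B) * norm (x - y)"
        if "c \<in> \<Omega>" "norm x \<le> R" "norm y \<le> R" for c x y
      proof -
        have "norm x * B \<le> R * B" "norm y * B \<le> R * B"
          using that \<open>B > 0\<close> by auto
        then have "norm (f c (k x) - f c (k y)) \<le> L * norm (k (x - y))"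
          unfolding k.diff by (intro L that order_trans[OF B(2)])
        also have "\<dots> \<le> L * (norm (x - y) * B)"
          using B(2)[of "x - y"] \<open>L > 0\<close> by (intro mult_left_mono) auto
        finally show ?thesis by (simp add: mult_ac)
      qed
      then show ?thesis by blast
    qed
  qed
qed

lemma control_field_compose_linear:
  assumes "control_field \<Omega> f" "bounded_linear h"
  shows "control_field \<Omega> (\<lambda>c x. h (f c x))"
proof -
  interpret h: bounded_linear h by fact
  obtain B where B: "B > 0" "\<And>x. norm (h x) \<le> norm x * B"
    using h.pos_bounded by blast
  have le: "norm (h x) \<le> N * B" if "norm x \<le> N" for x N
    using order_trans[OF B(2) mult_right_mono[OF that]] \<open>B > 0\<close> by simp
  obtain C where C: "C > 0" "\<And>c x. c \<in> \<Omega> \<Longrightarrow> norm (f c x) \<le> C * (1 + norm x)"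
    using control_field_growthE[OF assms(1)] by blast
  show ?thesis
  proof (rule control_fieldI)
    show "continuous_on UNIV (\<lambda>z. h (f (fst z) (snd z)))"
      using control_field_continuous[OF assms(1)] by (rule h.continuous_on)
    show "norm (h (f c x)) \<le> (C * B) * (1 + norm x)" if "c \<in> \<Omega>" for c x
      using le[OF C(2)[OF that]] by (simp add: mult_ac)
    show "\<exists>L. \<forall>c\<in>\<Omega>. \<forall>x y. norm x \<le> R \<longrightarrow> norm y \<le> R \<longrightarrow>
      norm (h (f c x) - h (f c y)) \<le> L * norm (x - y)" for R
    proof -
      obtain L where L: "L > 0" "\<And>c x y. c \<in> \<Omega> \<Longrightarrow> norm x \<le> R \<Longrightarrow> norm y \<le> R \<Longrightarrow>
          norm (f c x - f c y) \<le> L * norm (x - y)"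
        using control_field_lipschitzE[OF assms(1)] by blast
      have "norm (h (f c x) - h (f c y)) \<le> (L * B) * norm (x - y)"
        if "c \<in> \<Omega>" "norm x \<le> R" "norm y \<le> R" for c x y
        using le[OF L(2)[OF that]] by (simp add: h.diff mult_ac)
      then show ?thesis by blast
    qed
  qed
qed

lemma control_field_add:
  assumes "control_field \<Omega> f" "control_field \<Omega> g"
  shows "control_field \<Omega> (\<lambda>c x. f c x + g c x)"
proof -
  obtain C where C: "C > 0" "\<And>c x. c \<in> \<Omega> \<Longrightarrow> norm (f c x) \<le> C * (1 + norm x)"
    using control_field_growthE[OF assms(1)] by blast
  obtain C' where C': "C' > 0" "\<And>c x. c \<in> \<Omega> \<Longrightarrow> norm (g c x) \<le> C' * (1 + norm x)"
    using control_field_growthE[OF assms(2)] by blast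
  show ?thesis
  proof (rule control_fieldI)
    show "continuous_on UNIV (\<lambda>z. f (fst z) (snd z) + g (fst z) (snd z))"
      using assms by (intro continuous_on_add control_field_continuous)
    show "norm (f c x + g c x) \<le> (C + C') * (1 + norm x)" if "c \<in> \<Omega>" for c x
      using norm_triangle_mono[OF C(2)[OF that] C'(2)[OF that]] by (simp add: distrib_right)
    show "\<exists>L. \<forall>c\<in>\<Omega>. \<forall>x y. norm x \<le> R \<longrightarrow> norm y \<le> R \<longrightarrow>
      norm (f c x + g c x - (f c y + g c y)) \<le> L * norm (x - y)" for R
    proof -
      obtain L where L: "L > 0" "\<And>c x y. c \<in> \<Omega> \<Longrightarrow> norm x \<le> R \<Longrightarrow> norm y \<le> R \<Longrightarrow>
          norm (f c x - f c y) \<le> L * norm (x - y)"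
        using control_field_lipschitzE[OF assms(1)] by blast
      obtain L' where L': "L' > 0" "\<And>c x y. c \<in> \<Omega> \<Longrightarrow> norm x \<le> R \<Longrightarrow> norm y \<le> R \<Longrightarrow>
          norm (g c x - g c y) \<le> L' * norm (x - y)"
        using control_field_lipschitzE[OF assms(2)] by blast
      have "norm (f c x + g c x - (f c y + g c y)) \<le> (L + L') * norm (x - y)"
        if "c \<in> \<Omega>" "norm x \<le> R" "norm y \<le> R" for c x y
        using norm_triangle_mono[OF L(2)[OF that] L'(2)[OF that]] by (simp add: algebra_simps)
      then show ?thesis by blast
    qed
  qed
qed

lemma control_field_linear:
  assumes "bounded_linear h"
  shows "control_field \<Omega> (\<lambda>_. h)"
proof -
  have "control_field \<Omega> (\<lambda>_ x. x)"
    by (rule control_fieldI[where C = 1])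
      (auto intro!: continuous_intros exI[of _ "1::real"])
  from control_field_compose_linear[OF this assms] show ?thesis .
qed

lemma control_field_diff:
  assumes "control_field \<Omega> f" "control_field \<Omega> g"
  shows "control_field \<Omega> (\<lambda>c x. f c x - g c x)"
  using control_field_add[OF assms(1)
      control_field_compose_linear[OF assms(2) bounded_linear_minus[OF bounded_linear_ident]]]
  by simp

text \<open>A pair is the sum of two linear embeddings, so the estimates for sums and linear images
  suffice.\<close>

lemma control_field_Pair:
  assumes "control_field \<Omega> f" "control_field \<Omega> g"
  shows "control_field \<Omega> (\<lambda>c x. (f c x, g c x))"
proof -
  have "control_field \<Omega> (\<lambda>c x. (f c x, 0) + (0, g c x))"
    by (intro control_field_add control_field_compose_linear[OF assms(1)] control_field_compose_linear[OF assms(2)]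
     bounded_linear_Pair bounded_linear_ident bounded_linear_zero)
  then show ?thesis by simp
qed

text \<open>The composition with a measurable control is measurable by joint continuity, and the
  growth bound along a continuous curve is a continuous majorant on a compact interval.\<close>

lemma control_field_absolutely_integrable:
  assumes f: "control_field \<Omega> f" and \<alpha>: "admissible_control t \<Omega> \<alpha>" and x: "continuous_on {0..t} x"
  shows "(\<lambda>s. f (\<alpha> s) (x s)) absolutely_integrable_on {0..t}"
proof -
  obtain C where C: "C > 0" "\<And>c x. c \<in> \<Omega> \<Longrightarrow> norm (f c x) \<le> C * (1 + norm x)"
    using control_field_growthE[OF f] by blast
  show ?thesis
  proof (rule measurable_bounded_by_integrable_imp_absolutely_integrable)
    have "x \<in> borel_measurable (lebesgue_on {0..t})"
      using x by (intro continuous_imp_measurable_on_sets_lebesgue) auto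
    with \<alpha> show "(\<lambda>s. f (\<alpha> s) (x s)) \<in> borel_measurable (lebesgue_on {0..t})"
      unfolding admissible_control_def
      by (intro borel_measurable_continuous_Pair[OF _ _ control_field_continuous[OF f]]) simp_all
    show "(\<lambda>s. C * (1 + norm (x s))) integrable_on {0..t}"
      by (intro integrable_continuous_real continuous_intros x)
    show "norm (f (\<alpha> s) (x s)) \<le> C * (1 + norm (x s))" if "s \<in> {0..t}" for s
      using that \<alpha> by (intro C) (auto simp: admissible_control_def)
  qed auto
qed

section \<open>A priori bounds and global existence for controlled fields\<close>

text \<open>The field enters only through \<open>C\<close>. The same bound therefore serves every
  control, and also a truncated field with the same growth.\<close>

lemma caratheodory_growth_bound:
  assumes x: "caratheodory t x g x\<^sub>0" and "C > 0" and s: "s \<in> {0..t}"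
    and g: "\<And>s. s \<in> {0..t} \<Longrightarrow> norm (g s) \<le> C * (1 + norm (x s))"
  shows "norm (x s) \<le> 2 * (norm x\<^sub>0 + C * t) * exp (4 * C * t)"
proof (rule gronwall_running_bound[where g = "\<lambda>s. norm (x s)", OF _ \<open>C > 0\<close>])
  have cont: "continuous_on {0..t} x"
    by (rule caratheodory_continuous) fact
  then show "continuous_on {0..t} (\<lambda>s. norm (x s))"
    by (intro continuous_intros)
  show "0 \<le> norm x\<^sub>0 + C * t"
    using s \<open>C > 0\<close> by auto
  fix s N assume s: "s \<in> {0..t}" and N: "\<And>r. r \<in> {0..s} \<Longrightarrow> norm (x r) \<le> N"
  have int: "(\<lambda>r. norm (x r)) integrable_on {0..s}"
    using cont s by (intro integrable_continuous_real continuous_intros) (auto intro: continuous_on_subset)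
  have Cs: "C * s \<le> C * t" and "0 \<le> N"
    using s \<open>C > 0\<close> order_trans[OF norm_ge_zero N[of 0]] by auto
  have "norm (x s) \<le> norm x\<^sub>0 + integral {0..s} (\<lambda>r. C * (1 + norm (x r)))"
    using x _ s g
    by (rule caratheodory_norm_le) (intro integrable_continuous_real continuous_intros cont)
  also have "integral {0..s} (\<lambda>r. C * (1 + norm (x r))) = C * s + C * integral {0..s} (\<lambda>r. norm (x r))"
    unfolding distrib_left using s integral_add[OF integrable_const_ivl integrable_on_mult_right[OF int, of C], of C]
    by simp
  \<comment> \<open>The estimate is an ordinary integral inequality; the nonnegative
    \<open>N / 4\<close> is added to give it the shape of the Gronwall lemma.\<close>
  also have "norm x\<^sub>0 + (C * s + C * integral {0..s} (\<lambda>r. norm (x r))) \<le>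
      norm x\<^sub>0 + C * t + N / 4 + C * integral {0..s} (\<lambda>r. norm (x r))"
    using Cs \<open>0 \<le> N\<close> by linarith
  finally show "norm (x s) \<le> norm x\<^sub>0 + C * t + N / 4 + C * integral {0..s} (\<lambda>r. norm (x r))" .
qed (use s in auto)

text \<open>The field is Lipschitz only on balls, so the state is first projected onto the ball
  whose radius \<open>R\<close> is the a priori bound. The projection is nonexpansive and fixes 0:
  the truncated field is globally Lipschitz and grows no faster, its solution stays in the ball, and
  there the truncation does nothing.\<close>

lemma control_field_exists:
  fixes f :: "'c::euclidean_space \<Rightarrow> 'a::euclidean_space \<Rightarrow> 'a"
  assumes f: "control_field \<Omega> f" and \<alpha>: "admissible_control t \<Omega> \<alpha>" and "0 \<le> t"
  shows "\<exists>x. caratheodory t x (\<lambda>s. f (\<alpha> s) (x s)) x\<^sub>0"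
proof -
  obtain C where C: "C > 0" "\<And>c x. c \<in> \<Omega> \<Longrightarrow> norm (f c x) \<le> C * (1 + norm x)"
    using control_field_growthE[OF f] by blast
  define R where "R = 2 * (norm x\<^sub>0 + C * t) * exp (4 * C * t)"
  have "0 \<le> R" using \<open>C > 0\<close> \<open>0 \<le> t\<close> by (simp add: R_def)
  obtain L where L: "L > 0" "\<And>c x y. c \<in> \<Omega> \<Longrightarrow> norm x \<le> R \<Longrightarrow> norm y \<le> R \<Longrightarrow>
      norm (f c x - f c y) \<le> L * norm (x - y)"
    using control_field_lipschitzE[OF f] by blast
  define P where "P = closest_point (cball (0::'a) R)"
  have P_le: "norm (P x) \<le> R" for x
    using closest_point_in_set[of "cball (0::'a) R" x] \<open>0 \<le> R\<close> by (simp add: P_def)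
  have P_lip: "norm (P x - P y) \<le> norm (x - y)" for x y
    using closest_point_lipschitz[of "cball (0::'a) R" x y] \<open>0 \<le> R\<close>
    by (simp add: P_def dist_norm)
  have P_id: "P x = x" if "norm x \<le> R" for x
    using that by (simp add: P_def closest_point_self)
  have P_cont: "continuous_on S P" for S
    unfolding P_def using \<open>0 \<le> R\<close> by (intro continuous_on_closest_point) auto
  have \<alpha>_in: "\<alpha> s \<in> \<Omega>" if "s \<in> {0..t}" for s
    using \<alpha> that by (auto simp: admissible_control_def)
  have "\<exists>x. caratheodory t x (\<lambda>s. f (\<alpha> s) (P (x s))) x\<^sub>0"
  proof (rule caratheodory_exists_lipschitz[OF \<open>0 \<le> t\<close> \<open>L > 0\<close>])
    show "(\<lambda>s. f (\<alpha> s) (P (x s))) absolutely_integrable_on {0..t}" if "continuous_on {0..t} x" for x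
      using f \<alpha> continuous_on_compose2[OF P_cont[of UNIV] that]
      by (intro control_field_absolutely_integrable) auto
    show "norm (f (\<alpha> s) (P x) - f (\<alpha> s) (P y)) \<le> L * norm (x - y)" if "s \<in> {0..t}" for s x y
      using order_trans[OF L(2)[OF \<alpha>_in[OF that] P_le P_le] mult_left_mono[OF P_lip]] \<open>L > 0\<close>
      by simp
  qed
  then obtain x where x: "caratheodory t x (\<lambda>s. f (\<alpha> s) (P (x s))) x\<^sub>0" by blast
  have "norm (f (\<alpha> s) (P (x s))) \<le> C * (1 + norm (x s))" if "s \<in> {0..t}" for s
  proof -
    have "norm (P (x s)) \<le> norm (x s)"
      using P_lip[of "x s" 0] P_id[of 0] \<open>0 \<le> R\<close> by simp
    then have "C * (1 + norm (P (x s))) \<le> C * (1 + norm (x s))"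
      using \<open>C > 0\<close> by simp
    then show ?thesis
      using C(2)[OF \<alpha>_in[OF that], of "P (x s)"] by simp
  qed
  then have "norm (x s) \<le> R" if "s \<in> {0..t}" for s
    unfolding R_def using caratheodory_growth_bound[OF x \<open>C > 0\<close> that] by blast
  then have "caratheodory t x (\<lambda>s. f (\<alpha> s) (x s)) x\<^sub>0"
    using caratheodory_eq[OF x] P_id by simp
  then show ?thesis by blast
qed

section \<open>The three-scale system\<close>

lemma slow_combination_u:
  fixes u v p A P :: "real \<Rightarrow> real^'m" and D :: "real^'m^'m"
  assumes u: "caratheodory t u (\<lambda>s. - (D *v v s) - D *v p s + A s) u\<^sub>0"
    and p: "caratheodory t p (\<lambda>s. - ((1 / \<epsilon>) *\<^sub>R (v s - P s + p s))) p\<^sub>0" and "\<epsilon> \<noteq> 0"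
  shows "caratheodory t (\<lambda>s. u s - \<epsilon> *\<^sub>R (D *v p s)) (\<lambda>s. A s - D *v P s) (u\<^sub>0 - \<epsilon> *\<^sub>R (D *v p\<^sub>0))"
proof -
  interpret D: bounded_linear "(*v) D"
    by (rule matrix_vector_mul_bounded_linear)
  have "bounded_linear (\<lambda>x. - (\<epsilon> *\<^sub>R (D *v x)))"
    by (intro bounded_linear_minus bounded_linear_scaleR_right[THEN bounded_linear_compose]
        matrix_vector_mul_bounded_linear)
  from caratheodory_add[OF u caratheodory_bounded_linear[OF p this]]
  show ?thesis
    using \<open>\<epsilon> \<noteq> 0\<close>
    by (simp add: D.scaleR D.neg D.add D.diff algebra_simps)
qed

text \<open>Applied with \<open>c = \<epsilon>\<^sup>2\<close>: the relaxation of \<open>q\<close>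
  cancels the sum \<open>w + q\<close> that drives \<open>v\<close>.\<close>

lemma slow_combination_v:
  fixes v w q :: "real \<Rightarrow> 'a::euclidean_space"
  assumes v: "caratheodory t v (\<lambda>s. A s + w s + q s) v\<^sub>0"
    and q: "caratheodory t q (\<lambda>s. - ((1 / c) *\<^sub>R (w s - N s + q s))) q\<^sub>0" and "c \<noteq> 0"
  shows "caratheodory t (\<lambda>s. v s + c *\<^sub>R q s) (\<lambda>s. A s + N s) (v\<^sub>0 + c *\<^sub>R q\<^sub>0)"
  using caratheodory_add[OF v caratheodory_bounded_linear[OF q bounded_linear_scaleR_right[of c]]] \<open>c \<noteq> 0\<close>
  by (simp add: algebra_simps)

text \<open>\<open>p\<close> relaxes towards \<open>P - v\<close>, and the maximum principle does
  not see the rate \<open>1 / c\<close>; this makes the bound uniform in \<epsilon>. Adding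
  \<open>norm p\<^sub>0\<close> gives one number above both the target and the initial
  value.\<close>

lemma fast_bound:
  fixes v p P :: "real \<Rightarrow> 'a::euclidean_space"
  assumes p: "caratheodory t p (\<lambda>s. - ((1 / c) *\<^sub>R (v s - P s + p s))) p\<^sub>0" and "c > 0"
    and M: "\<And>s. s \<in> {0..t} \<Longrightarrow> norm (P s - v s) \<le> M" and s: "s \<in> {0..t}"
  shows "norm (p s) \<le> norm p\<^sub>0 + M"
proof (rule relaxation_bound[of t p "1 / c" "\<lambda>s. P s - v s" p\<^sub>0])
  show "caratheodory t p (\<lambda>s. - ((1 / c) *\<^sub>R (p s - (P s - v s)))) p\<^sub>0"
    using p by (simp add: algebra_simps)
  have "0 \<le> M" using order_trans[OF norm_ge_zero M[OF s]] .
  then show "norm p\<^sub>0 \<le> norm p\<^sub>0 + M" by simp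
  show "norm (P s - v s) \<le> norm p\<^sub>0 + M" if "s \<in> {0..t}" for s
    using M[OF that] by (simp add: add_increasing)
qed (use \<open>c > 0\<close> s in auto)

lemma three_scale_bound:
  fixes u v w p q A P N :: "real \<Rightarrow> real^'m" and D :: "real^'m^'m"
  assumes u: "caratheodory t u (\<lambda>s. - (D *v v s) - D *v p s + A s) u\<^sub>0"
    and v: "caratheodory t v (\<lambda>s. - (a *\<^sub>R (D *v u s)) + w s + q s) v\<^sub>0"
    and w: "caratheodory t w (\<lambda>s. - (b *\<^sub>R (D *v u s))) w\<^sub>0"
    and p: "caratheodory t p (\<lambda>s. - ((1 / \<epsilon>) *\<^sub>R (v s - P s + p s))) p\<^sub>0"
    and q: "caratheodory t q (\<lambda>s. - ((1 / \<epsilon>\<^sup>2) *\<^sub>R (w s - N s + q s))) q\<^sub>0"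
    and C: "1 \<le> C" "\<And>x. norm (D *v x) \<le> C * norm x" "\<And>x. norm (a *\<^sub>R (D *v x)) \<le> C * norm x"
      "\<And>x. norm (b *\<^sub>R (D *v x)) \<le> C * norm x"
    and A: "\<And>s. s \<in> {0..t} \<Longrightarrow> norm (A s) \<le> C * (1 + norm (u s))"
    and P: "\<And>s. s \<in> {0..t} \<Longrightarrow> norm (P s) \<le> C * (1 + norm (u s))"
    and N: "\<And>s. s \<in> {0..t} \<Longrightarrow> norm (N s) \<le> C * (1 + norm (u s))"
    and \<epsilon>: "0 < \<epsilon>" "\<epsilon> * C\<^sup>2 \<le> 1 / 8" and "t \<le> 1" and s: "s \<in> {0..t}"
  defines "B \<equiv> 2 * (norm u\<^sub>0 + norm v\<^sub>0 + norm w\<^sub>0 + norm p\<^sub>0 + norm q\<^sub>0 + 6 * C\<^sup>2 + 1) * exp (24 * C\<^sup>2)"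
  shows "norm (u s) \<le> B" "norm (p s) \<le> norm p\<^sub>0 + C * (1 + B)"
proof -
  define X where "X s = norm (u s) + norm (v s) + norm (w s)" for s
  have cont: "continuous_on {0..t} X"
    unfolding X_def using u v w by (intro continuous_intros caratheodory_continuous)
  have C2: "C \<le> C\<^sup>2" "1 \<le> C\<^sup>2"
    using C(1) by (auto simp: power2_eq_square mult_ge1_I)
  have "\<epsilon> * C \<le> \<epsilon> * C\<^sup>2" "\<epsilon> \<le> \<epsilon> * C\<^sup>2"
    using C2 \<epsilon>(1) by auto
  then have \<epsilon>': "\<epsilon> * C \<le> 1 / 8" "\<epsilon> \<le> 1 / 8"
    using \<epsilon>(2) by auto
  have \<epsilon>2: "\<epsilon>\<^sup>2 \<le> 1 / 8" "\<epsilon>\<^sup>2 * C \<le> 1 / 8"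
  proof -
    have "\<epsilon> * \<epsilon> \<le> \<epsilon> * 1" "\<epsilon> * (\<epsilon> * C) \<le> \<epsilon> * 1"
      using \<epsilon>' \<epsilon>(1) by (auto intro!: mult_left_mono)
    then show "\<epsilon>\<^sup>2 \<le> 1 / 8" "\<epsilon>\<^sup>2 * C \<le> 1 / 8"
      using \<epsilon>' by (auto simp: power2_eq_square mult.assoc)
  qed
  \<comment> \<open>The fast bounds are applied on \<open>{0..s}\<close>, so that only the supremum
    of \<open>X\<close> up to \<open>s\<close> enters, as the Gronwall lemma demands.\<close>
  have fast: "norm (p s) \<le> norm p\<^sub>0 + C * (1 + M)" "norm (q s) \<le> norm q\<^sub>0 + C * (1 + M)"
    if s: "s \<in> {0..t}" and M: "\<And>r. r \<in> {0..s} \<Longrightarrow> X r \<le> M" for s M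
  proof -
    have le: "norm (f - y) \<le> C * (1 + M)"
      if "norm f \<le> C * (1 + norm (u r))" "norm (u r) + norm y \<le> X r" "r \<in> {0..s}" for f y r
    proof -
      have "norm (f - y) \<le> C * (1 + norm (u r)) + C * norm y"
        using norm_triangle_ineq4[of f y] that(1) mult_right_mono[OF C(1), of "norm y"] by simp
      also have "\<dots> = C * (1 + (norm (u r) + norm y))"
        by (simp add: algebra_simps)
      also have "\<dots> \<le> C * (1 + M)"
        using C(1) that(2) M[OF that(3)] by (intro mult_left_mono) auto
      finally show ?thesis .
    qed
    show "norm (p s) \<le> norm p\<^sub>0 + C * (1 + M)"
      using s P \<epsilon>(1)
      by (intro fast_bound[OF caratheodory_subinterval[OF p]] le) (auto simp: X_def)
    show "norm (q s) \<le> norm q\<^sub>0 + C * (1 + M)"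
      using s N \<epsilon>(1)
      by (intro fast_bound[OF caratheodory_subinterval[OF q]] le) (auto simp: X_def)
  qed
  \<comment> \<open>To be used for \<open>u - \<epsilon> D p\<close>,
    \<open>v + \<epsilon>\<^sup>2 q\<close> and \<open>w\<close>. After the cancellations their
    drifts are bounded in terms of \<open>u\<close> alone; the product of \<open>D\<close> with the
    bound on \<open>P\<close> is the source of \<open>C\<^sup>2\<close>.\<close>
  have slow: "norm (y s) \<le> norm y\<^sub>0 + 2 * C\<^sup>2 + 2 * C\<^sup>2 * integral {0..s} X"
    if y: "caratheodory t y g y\<^sub>0" and s: "s \<in> {0..t}"
      and g: "\<And>r. r \<in> {0..t} \<Longrightarrow> norm (g r) \<le> 2 * C\<^sup>2 * (1 + norm (u r))" for y g y\<^sub>0 s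
  proof -
    have int: "X integrable_on {0..s}"
      using cont s by (intro integrable_continuous_real) (auto intro: continuous_on_subset)
    have le: "norm (g r) \<le> 2 * C\<^sup>2 * (1 + X r)" if "r \<in> {0..t}" for r
    proof -
      have "2 * C\<^sup>2 * (1 + norm (u r)) \<le> 2 * C\<^sup>2 * (1 + X r)"
        unfolding X_def by (intro mult_left_mono) auto
      then show ?thesis using g[OF that] by simp
    qed
    have "norm (y s) \<le> norm y\<^sub>0 + integral {0..s} (\<lambda>r. 2 * C\<^sup>2 * (1 + X r))"
      using y _ s le
      by (rule caratheodory_norm_le) (intro integrable_continuous_real continuous_intros cont)
    also have "integral {0..s} (\<lambda>r. 2 * C\<^sup>2 * (1 + X r)) = 2 * C\<^sup>2 * s + 2 * C\<^sup>2 * integral {0..s} X"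
      unfolding distrib_left
      using s integral_add[OF integrable_const_ivl integrable_on_mult_right[OF int, of "2 * C\<^sup>2"], of "2 * C\<^sup>2"]
      by simp
    also have "2 * C\<^sup>2 * s \<le> 2 * C\<^sup>2 * 1"
      using s \<open>t \<le> 1\<close> by (intro mult_left_mono) auto
    finally show ?thesis by simp
  qed
  have slow_u: "norm (A r - D *v P r) \<le> 2 * C\<^sup>2 * (1 + norm (u r))" if "r \<in> {0..t}" for r
  proof -
    have "norm (D *v P r) \<le> C * (C * (1 + norm (u r)))"
      using order_trans[OF C(2) mult_left_mono[OF P[OF that]]] C(1) by simp
    moreover have "C * (1 + norm (u r)) \<le> C\<^sup>2 * (1 + norm (u r))"
      using C2 by (intro mult_right_mono) auto
    ultimately show ?thesis
      using norm_triangle_ineq4[of "A r" "D *v P r"] A[OF that] by (simp add: power2_eq_square)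
  qed
  have lin: "C * norm (u r) \<le> C\<^sup>2 * (1 + norm (u r))" "C * (1 + norm (u r)) \<le> C\<^sup>2 * (1 + norm (u r))" for r
    using C C2 by (auto intro!: mult_mono)
  have slow_v: "norm (- (a *\<^sub>R (D *v u r)) + N r) \<le> 2 * C\<^sup>2 * (1 + norm (u r))" if "r \<in> {0..t}" for r
    using norm_triangle_ineq[of "- (a *\<^sub>R (D *v u r))" "N r"] C(3)[of "u r"] N[OF that] lin[of r]
    unfolding norm_minus_cancel by linarith
  have slow_w: "norm (- (b *\<^sub>R (D *v u r))) \<le> 2 * C\<^sup>2 * (1 + norm (u r))" for r
  proof -
    have "0 \<le> C\<^sup>2 * (1 + norm (u r))" by simp
    then show ?thesis
      using C(4)[of "u r"] lin(1)[of r] unfolding norm_minus_cancel by linarith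
  qed
  \<comment> \<open>Three drifts contribute \<open>2 * C\<^sup>2\<close> each; the final 1 covers
    the constant 1/4 left by the two fast bounds. The Gronwall rate \<open>6 * C\<^sup>2\<close>
    then produces the exponent \<open>24 * C\<^sup>2\<close> of \<open>B\<close>, since the horizon
    is at most 1.\<close>
  define A0 where "A0 = norm u\<^sub>0 + norm v\<^sub>0 + norm w\<^sub>0 + norm p\<^sub>0 + norm q\<^sub>0 + 6 * C\<^sup>2 + 1"
  have X_le: "X s \<le> B" if s: "s \<in> {0..t}" for s
  proof -
    have "X s \<le> 2 * A0 * exp (4 * (6 * C\<^sup>2) * t)"
    proof (rule gronwall_running_bound[OF cont _ _ _ _ s])
      show "0 < 6 * C\<^sup>2" using C2(2) by linarith
      show "0 \<le> A0" by (simp add: A0_def)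
      show "0 \<le> X s" for s by (simp add: X_def)
      fix s M assume s: "s \<in> {0..t}" and M: "\<And>r. r \<in> {0..s} \<Longrightarrow> X r \<le> M"
      have "0 \<le> X s" by (simp add: X_def)
      then have "0 \<le> M" using M[of s] s by simp
      let ?I = "integral {0..s} X"
      note fast = fast[OF s M]
      have Dp: "norm (\<epsilon> *\<^sub>R (D *v x)) \<le> \<epsilon> * C * norm x" for x
        using C(2)[of x] \<epsilon>(1) by (simp add: mult_left_mono mult.assoc)
      have Dp0: "norm (\<epsilon> *\<^sub>R (D *v p\<^sub>0)) \<le> 1 / 8 * norm p\<^sub>0"
        using Dp[of "p\<^sub>0"] mult_right_mono[OF \<epsilon>'(1), of "norm p\<^sub>0"] by simp
      have Dps: "norm (\<epsilon> *\<^sub>R (D *v p s)) \<le> 1 / 8 * norm p\<^sub>0 + 1 / 8 * (1 + M)"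
      proof -
        have "\<epsilon> * C * norm (p s) \<le> \<epsilon> * C * (norm p\<^sub>0 + C * (1 + M))"
          using fast(1) \<epsilon>(1) C(1) by (intro mult_left_mono) auto
        also have "\<dots> = \<epsilon> * C * norm p\<^sub>0 + \<epsilon> * C\<^sup>2 * (1 + M)"
          by (simp add: power2_eq_square algebra_simps)
        also have "\<dots> \<le> 1 / 8 * norm p\<^sub>0 + 1 / 8 * (1 + M)"
          using \<epsilon>'(1) \<epsilon>(2) \<open>0 \<le> M\<close> by (intro add_mono mult_right_mono) auto
        finally show ?thesis using Dp[of "p s"] by simp
      qed
      have q0: "norm (\<epsilon>\<^sup>2 *\<^sub>R q\<^sub>0) \<le> 1 / 8 * norm q\<^sub>0"
        using mult_right_mono[OF \<epsilon>2(1), of "norm q\<^sub>0"] by simp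
      have qs: "norm (\<epsilon>\<^sup>2 *\<^sub>R q s) \<le> 1 / 8 * norm q\<^sub>0 + 1 / 8 * (1 + M)"
      proof -
        have "norm (\<epsilon>\<^sup>2 *\<^sub>R q s) \<le> \<epsilon>\<^sup>2 * (norm q\<^sub>0 + C * (1 + M))"
          using fast(2) by (simp add: mult_left_mono)
        also have "\<dots> = \<epsilon>\<^sup>2 * norm q\<^sub>0 + \<epsilon>\<^sup>2 * C * (1 + M)"
          by (simp add: algebra_simps)
        also have "\<dots> \<le> 1 / 8 * norm q\<^sub>0 + 1 / 8 * (1 + M)"
          using \<epsilon>2 \<open>0 \<le> M\<close> by (intro add_mono mult_right_mono) auto
        finally show ?thesis .
      qed
      have Y: "norm (u s - \<epsilon> *\<^sub>R (D *v p s)) \<le> norm (u\<^sub>0 - \<epsilon> *\<^sub>R (D *v p\<^sub>0)) + 2 * C\<^sup>2 + 2 * C\<^sup>2 * ?I"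
        using slow_combination_u[OF u p] \<epsilon>(1) s slow_u by (intro slow) auto
      have Z: "norm (v s + \<epsilon>\<^sup>2 *\<^sub>R q s) \<le> norm (v\<^sub>0 + \<epsilon>\<^sup>2 *\<^sub>R q\<^sub>0) + 2 * C\<^sup>2 + 2 * C\<^sup>2 * ?I"
        using slow_combination_v[OF v q] \<epsilon>(1) s slow_v by (intro slow) auto
      have W: "norm (w s) \<le> norm w\<^sub>0 + 2 * C\<^sup>2 + 2 * C\<^sup>2 * ?I"
        using w s slow_w by (rule slow)
      have us: "norm (u s) \<le> norm (u s - \<epsilon> *\<^sub>R (D *v p s)) + norm (\<epsilon> *\<^sub>R (D *v p s))"
        using norm_triangle_ineq[of "u s - \<epsilon> *\<^sub>R (D *v p s)" "\<epsilon> *\<^sub>R (D *v p s)"] by simp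
      have vs: "norm (v s) \<le> norm (v s + \<epsilon>\<^sup>2 *\<^sub>R q s) + norm (\<epsilon>\<^sup>2 *\<^sub>R q s)"
        using norm_triangle_ineq4[of "v s + \<epsilon>\<^sup>2 *\<^sub>R q s" "\<epsilon>\<^sup>2 *\<^sub>R q s"] by simp
      have "norm (u s) + norm (v s) + norm (w s) \<le> norm u\<^sub>0 + norm v\<^sub>0 + norm w\<^sub>0 + 1 / 4 * norm p\<^sub>0 + 1 / 4 * norm q\<^sub>0 + 1 / 4 * (1 + M)
          + 6 * C\<^sup>2 + 6 * C\<^sup>2 * ?I"
        using us vs W Y Z Dps qs Dp0 q0 norm_triangle_ineq4[of "u\<^sub>0" "\<epsilon> *\<^sub>R (D *v p\<^sub>0)"]
          norm_triangle_ineq[of "v\<^sub>0" "\<epsilon>\<^sup>2 *\<^sub>R q\<^sub>0"] by argo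
      then show "X s \<le> A0 + M / 4 + 6 * C\<^sup>2 * ?I"
        using X_def[of s] norm_ge_zero[of "p\<^sub>0"] norm_ge_zero[of "q\<^sub>0"] unfolding A0_def by argo
    qed
    also have "\<dots> \<le> 2 * A0 * exp (24 * C\<^sup>2)"
      using \<open>t \<le> 1\<close> by (intro mult_left_mono) (auto simp: A0_def mult_left_le)
    finally show ?thesis by (simp add: A0_def B_def)
  qed
  show "norm (p s) \<le> norm p\<^sub>0 + C * (1 + B)"
    using s by (intro fast X_le) auto
  have "norm (u s) \<le> X s" by (simp add: X_def)
  then show "norm (u s) \<le> B" using X_le[OF s] by simp
qed

section \<open>Uniform distance between the two slow trajectories\<close>

text \<open>The combination \<open>u - \<epsilon> D p\<close> and \<open>U\<close> have the same
  field \<open>f\<close>, evaluated at \<open>u\<close> and at \<open>U\<close>. Hence the error is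
  driven only by the shift \<open>\<epsilon> D p\<close>, at time 0 and at the current time. All
  constants are fixed from \<rho> and the data first, which makes the threshold for \<epsilon>
  independent of controls, horizon and initial point.\<close>

lemma three_scale_comparison:
  fixes D :: "real^'m^'m" and a b \<rho> \<delta> :: real
    and F0 F1 :: "real^'m \<Rightarrow> real^'m"
    and H :: "real^'m \<Rightarrow> real^'i^'m" and G :: "real^'m \<Rightarrow> real^'j^'m" and K :: "real^'m \<Rightarrow> real^'k^'m"
  assumes bounded: "bounded \<Omega>\<^sub>A" "bounded \<Omega>\<^sub>B" "bounded \<Omega>\<^sub>\<Gamma>"
    and F0: "locally_lipschitz F0" "linear_growth F0"
    and F1: "locally_lipschitz F1" "linear_growth F1"
    and H: "locally_lipschitz H" "linear_growth H"
    and G: "locally_lipschitz G" "linear_growth G"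
    and K: "locally_lipschitz K" "linear_growth K"
    and \<rho>: "0 \<le> \<rho>" and \<delta>: "0 < \<delta>"
  obtains \<epsilon>\<^sub>0 where "0 < \<epsilon>\<^sub>0"
    "\<And>\<epsilon> t \<alpha> \<beta> \<gamma> u\<^sub>0 v\<^sub>0 w\<^sub>0 p\<^sub>0 q\<^sub>0 u v w p q U s.
      0 < \<epsilon> \<Longrightarrow> \<epsilon> < \<epsilon>\<^sub>0 \<Longrightarrow> t \<le> 1 \<Longrightarrow>
      admissible_control t \<Omega>\<^sub>A \<alpha> \<Longrightarrow> admissible_control t \<Omega>\<^sub>B \<beta> \<Longrightarrow> admissible_control t \<Omega>\<^sub>\<Gamma> \<gamma> \<Longrightarrow>
      norm u\<^sub>0 \<le> \<rho> \<Longrightarrow> norm v\<^sub>0 \<le> \<rho> \<Longrightarrow> norm w\<^sub>0 \<le> \<rho> \<Longrightarrow> norm p\<^sub>0 \<le> \<rho> \<Longrightarrow> norm q\<^sub>0 \<le> \<rho> \<Longrightarrow>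
      three_scale_solution D a b F0 F1 H G K \<epsilon> t \<alpha> \<beta> \<gamma> (u\<^sub>0, v\<^sub>0, w\<^sub>0, p\<^sub>0, q\<^sub>0) u v w p q \<Longrightarrow>
      limit_solution D F0 H G t \<alpha> \<beta> u\<^sub>0 U \<Longrightarrow> s \<in> {0..t} \<Longrightarrow> norm (u s - U s) < \<delta>"
proof -
  have bdd: "bounded (fst ` (\<Omega>\<^sub>A \<times> \<Omega>\<^sub>B))" "bounded (snd ` (\<Omega>\<^sub>A \<times> \<Omega>\<^sub>B))"
    using bounded by (auto intro: bounded_subset)
  define fA where "fA c x = H x *v c" for c x
  define fP where "fP c x = F0 x + G x *v c" for c x
  define fN where "fN c x = F1 x + K x *v c" for c x
  define f where "f c x = fA (fst c) x - D *v fP (snd c) x" for c x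
  have A: "control_field \<Omega>\<^sub>A fA"
    unfolding fA_def[abs_def] using bounded by (intro control_field_mult H) auto
  have P: "control_field \<Omega>\<^sub>B fP"
    unfolding fP_def[abs_def] using bounded
    by (intro control_field_add control_field_state control_field_mult F0 G) auto
  have N: "control_field \<Omega>\<^sub>\<Gamma> fN"
    unfolding fN_def[abs_def] using bounded
    by (intro control_field_add control_field_state control_field_mult F1 K) auto
  have f: "control_field (\<Omega>\<^sub>A \<times> \<Omega>\<^sub>B) f"
    unfolding f_def[abs_def] fA_def fP_def using bdd
    by (intro control_field_diff control_field_compose_linear[OF _ matrix_vector_mul_bounded_linear]
        control_field_add control_field_state control_field_mult F0 G H) (auto intro: continuous_intros)
  obtain CA where CA: "CA > 0" "\<And>c x. c \<in> \<Omega>\<^sub>A \<Longrightarrow> norm (fA c x) \<le> CA * (1 + norm x)"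
    using control_field_growthE[OF A] by blast
  obtain CP where CP: "CP > 0" "\<And>c x. c \<in> \<Omega>\<^sub>B \<Longrightarrow> norm (fP c x) \<le> CP * (1 + norm x)"
    using control_field_growthE[OF P] by blast
  obtain CN where CN: "CN > 0" "\<And>c x. c \<in> \<Omega>\<^sub>\<Gamma> \<Longrightarrow> norm (fN c x) \<le> CN * (1 + norm x)"
    using control_field_growthE[OF N] by blast
  obtain CF where CF: "CF > 0" "\<And>c x. c \<in> \<Omega>\<^sub>A \<times> \<Omega>\<^sub>B \<Longrightarrow> norm (f c x) \<le> CF * (1 + norm x)"
    using control_field_growthE[OF f] by blast
  interpret D: bounded_linear "(*v) D"
    by (rule matrix_vector_mul_bounded_linear)
  obtain CD where CD: "CD > 0" "\<And>x. norm (D *v x) \<le> norm x * CD"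
    using D.pos_bounded by blast
  define C where "C = 1 + CA + CP + CN + CD + \<bar>a\<bar> * CD + \<bar>b\<bar> * CD"
  have nonneg: "0 \<le> \<bar>a\<bar> * CD" "0 \<le> \<bar>b\<bar> * CD" using CD by auto
  have C_ge: "1 \<le> C" "CA \<le> C" "CP \<le> C" "CN \<le> C" "CD \<le> C" "\<bar>a\<bar> * CD \<le> C" "\<bar>b\<bar> * CD \<le> C"
    unfolding C_def using nonneg CA(1) CP(1) CN(1) CD(1) by linarith+
  have D_le: "norm (D *v x) \<le> C * norm x" for x
    using order_trans[OF CD(2) mult_left_mono[OF C_ge(5)], of x] by (simp add: mult.commute)
  have scaled_D_le: "norm (r *\<^sub>R (D *v x)) \<le> C * norm x" if "\<bar>r\<bar> * CD \<le> C" for r x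
  proof -
    have "norm (r *\<^sub>R (D *v x)) \<le> \<bar>r\<bar> * (norm x * CD)"
      using CD(2) by (simp add: mult_left_mono)
    also have "\<dots> = (\<bar>r\<bar> * CD) * norm x"
      by simp
    also have "\<dots> \<le> C * norm x"
      using that by (intro mult_right_mono) auto
    finally show ?thesis .
  qed
  \<comment> \<open>The bound of \<open>three_scale_bound\<close> with every initial norm replaced
    by \<rho>; \<open>M\<close> is the resulting bound on \<open>p\<close>.\<close>
  define B where "B = 2 * (\<rho> + \<rho> + \<rho> + \<rho> + \<rho> + 6 * C\<^sup>2 + 1) * exp (24 * C\<^sup>2)"
  have "0 \<le> B" using \<rho> by (simp add: B_def)
  define M where "M = \<rho> + C * (1 + B)"
  \<comment> \<open>The ball has to contain \<open>u\<close> and \<open>U\<close>: the second entry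
    is the growth bound for the limit equation with \<rho> for the initial norm and 1 for the
    horizon.\<close>
  define R where "R = max B (2 * (\<rho> + CF) * exp (4 * CF))"
  obtain L where L: "L > 0" "\<And>c x y. c \<in> \<Omega>\<^sub>A \<times> \<Omega>\<^sub>B \<Longrightarrow> norm x \<le> R \<Longrightarrow> norm y \<le> R \<Longrightarrow>
      norm (f c x - f c y) \<le> L * norm (x - y)"
    using control_field_lipschitzE[OF f] by blast
  define \<kappa> where "\<kappa> = 2 * (C * (\<rho> + M)) * exp (4 * L)"
  have "0 \<le> M" using \<rho> \<open>0 \<le> B\<close> C_ge(1) by (simp add: M_def)
  then have "0 \<le> \<kappa>" using \<rho> C_ge(1) by (simp add: \<kappa>_def)
  \<comment> \<open>The first entry permits the uniform bounds, the second makes the final error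
    \<open>\<epsilon> * \<kappa>\<close> smaller than \<delta>; adding 1 to \<kappa> avoids division
    by 0.\<close>
  define \<epsilon>\<^sub>0 where "\<epsilon>\<^sub>0 = min (1 / (8 * C\<^sup>2)) (\<delta> / (\<kappa> + 1))"
  show thesis
  proof (rule that[of \<epsilon>\<^sub>0])
    show "0 < \<epsilon>\<^sub>0" using \<delta> C_ge(1) \<open>0 \<le> \<kappa>\<close> by (simp add: \<epsilon>\<^sub>0_def)
    fix \<epsilon> t \<alpha> \<beta> \<gamma> u\<^sub>0 v\<^sub>0 w\<^sub>0 p\<^sub>0 q\<^sub>0 u v w p q U s
    assume \<epsilon>: "0 < \<epsilon>" "\<epsilon> < \<epsilon>\<^sub>0" and "t \<le> 1"
      and adm: "admissible_control t \<Omega>\<^sub>A \<alpha>" "admissible_control t \<Omega>\<^sub>B \<beta>" "admissible_control t \<Omega>\<^sub>\<Gamma> \<gamma>"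
      and init: "norm u\<^sub>0 \<le> \<rho>" "norm v\<^sub>0 \<le> \<rho>" "norm w\<^sub>0 \<le> \<rho>" "norm p\<^sub>0 \<le> \<rho>" "norm q\<^sub>0 \<le> \<rho>"
      and sol: "three_scale_solution D a b F0 F1 H G K \<epsilon> t \<alpha> \<beta> \<gamma> (u\<^sub>0, v\<^sub>0, w\<^sub>0, p\<^sub>0, q\<^sub>0) u v w p q"
      and lim: "limit_solution D F0 H G t \<alpha> \<beta> u\<^sub>0 U" and s: "s \<in> {0..t}"
    have "0 \<le> t" using s by simp
    have \<epsilon>C: "\<epsilon> * C\<^sup>2 \<le> 1 / 8"
      using \<epsilon>(2) C_ge(1) by (simp add: \<epsilon>\<^sub>0_def field_simps)
    have \<epsilon>\<delta>: "\<epsilon> * \<kappa> < \<delta>"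
    proof -
      have "\<epsilon> * (\<kappa> + 1) < \<delta>"
        using \<epsilon>(2) \<open>0 \<le> \<kappa>\<close> by (simp add: \<epsilon>\<^sub>0_def pos_less_divide_eq)
      then show ?thesis using \<epsilon>(1) by (simp add: algebra_simps)
    qed
    have in_A: "\<alpha> r \<in> \<Omega>\<^sub>A" and in_B: "\<beta> r \<in> \<Omega>\<^sub>B" and in_\<Gamma>: "\<gamma> r \<in> \<Omega>\<^sub>\<Gamma>" if "r \<in> {0..t}" for r
      using adm that by (auto simp: admissible_control_def)
    let ?A = "\<lambda>s. fA (\<alpha> s) (u s)" and ?P = "\<lambda>s. fP (\<beta> s) (u s)" and ?N = "\<lambda>s. fN (\<gamma> s) (u s)"
    have u: "caratheodory t u (\<lambda>s. - (D *v v s) - D *v p s + ?A s) u\<^sub>0"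
      and v: "caratheodory t v (\<lambda>s. - (a *\<^sub>R (D *v u s)) + w s + q s) v\<^sub>0"
      and w: "caratheodory t w (\<lambda>s. - (b *\<^sub>R (D *v u s))) w\<^sub>0"
      and p: "caratheodory t p (\<lambda>s. - ((1 / \<epsilon>) *\<^sub>R (v s - ?P s + p s))) p\<^sub>0"
      and q: "caratheodory t q (\<lambda>s. - ((1 / \<epsilon>\<^sup>2) *\<^sub>R (w s - ?N s + q s))) q\<^sub>0"
      using sol by (simp_all add: three_scale_solution_def fA_def fP_def fN_def diff_diff_eq)
    have U: "caratheodory t U (\<lambda>s. f (\<alpha> s, \<beta> s) (U s)) u\<^sub>0"
      using lim by (simp add: limit_solution_def f_def fA_def fP_def)
    have le_C: "norm y \<le> C * (1 + norm x)" if "norm y \<le> c * (1 + norm x)" "c \<le> C"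
      for x y :: "real^'m" and c
      using order_trans[OF that(1) mult_right_mono[OF that(2)]] by simp
    have A_le: "norm (?A r) \<le> C * (1 + norm (u r))"
      and P_le: "norm (?P r) \<le> C * (1 + norm (u r))"
      and N_le: "norm (?N r) \<le> C * (1 + norm (u r))" if "r \<in> {0..t}" for r
      using le_C[OF CA(2)[OF in_A[OF that]] C_ge(2)] le_C[OF CP(2)[OF in_B[OF that]] C_ge(3)]
        le_C[OF CN(2)[OF in_\<Gamma>[OF that]] C_ge(4)] by auto
    define B' where "B' = 2 * (norm u\<^sub>0 + norm v\<^sub>0 + norm w\<^sub>0 + norm p\<^sub>0 + norm q\<^sub>0 + 6 * C\<^sup>2 + 1) * exp (24 * C\<^sup>2)"
    have "B' \<le> B"
      unfolding B_def B'_def using init by (intro mult_right_mono mult_left_mono add_mono) auto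
    have bound: "norm (u r) \<le> B'" "norm (p r) \<le> norm p\<^sub>0 + C * (1 + B')" if "r \<in> {0..t}" for r
      unfolding B'_def using that
      by (intro three_scale_bound[OF u v w p q C_ge(1) D_le scaled_D_le scaled_D_le A_le P_le N_le \<epsilon>(1) \<epsilon>C \<open>t \<le> 1\<close>]
          C_ge; simp)+
    have u_le: "norm (u r) \<le> R" if "r \<in> {0..t}" for r
      using bound(1)[OF that] \<open>B' \<le> B\<close> by (simp add: R_def)
    have p_le: "norm (p r) \<le> M" if "r \<in> {0..t}" for r
    proof -
      have "C * (1 + B') \<le> C * (1 + B)" using \<open>B' \<le> B\<close> C_ge(1) by simp
      then show ?thesis using bound(2)[OF that] init(4) by (simp add: M_def)
    qed
    have U_le: "norm (U r) \<le> R" if "r \<in> {0..t}" for r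
    proof -
      have "norm (U r) \<le> 2 * (norm u\<^sub>0 + CF * t) * exp (4 * CF * t)"
        using U CF(1) that CF(2) in_A in_B by (intro caratheodory_growth_bound) auto
      also have "\<dots> \<le> 2 * (\<rho> + CF) * exp (4 * CF)"
        using init(1) CF(1) \<open>t \<le> 1\<close> \<open>0 \<le> t\<close> \<rho>
        by (intro mult_mono add_mono) (auto simp: mult_left_le)
      finally show ?thesis by (simp add: R_def)
    qed
    let ?e = "\<lambda>r. norm (u r - U r)"
    have cont: "continuous_on {0..t} ?e"
      using u U by (intro continuous_intros caratheodory_continuous)
    \<comment> \<open>The drift compares \<open>f\<close> at \<open>u\<close> and \<open>U\<close>,
      not at the combination, so the integrand is directly bounded by \<open>L\<close> times the
      error and the shift stays outside the integral.\<close>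
    have diff: "caratheodory t (\<lambda>s. (u s - \<epsilon> *\<^sub>R (D *v p s)) + - U s)
        (\<lambda>s. f (\<alpha> s, \<beta> s) (u s) + - f (\<alpha> s, \<beta> s) (U s)) (u\<^sub>0 - \<epsilon> *\<^sub>R (D *v p\<^sub>0) + - u\<^sub>0)"
      using slow_combination_u[OF u p] \<epsilon>(1) unfolding f_def
      by (intro caratheodory_add caratheodory_bounded_linear[OF _ bounded_linear_minus[OF bounded_linear_ident]]
          U[unfolded f_def]) auto
    have Dp: "norm (\<epsilon> *\<^sub>R (D *v x)) \<le> \<epsilon> * C * m" if "norm x \<le> m" for x m
    proof -
      have "\<epsilon> * norm (D *v x) \<le> \<epsilon> * (C * m)"
        using order_trans[OF D_le mult_left_mono[OF that]] C_ge(1) \<epsilon>(1) by (intro mult_left_mono) auto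
      then show ?thesis using \<epsilon>(1) by (simp add: mult.assoc)
    qed
    have "?e s \<le> 2 * (\<epsilon> * C * (\<rho> + M)) * exp (4 * L * t)"
    proof (rule gronwall_running_bound[where g = ?e, OF cont L(1) _ _ _ s])
      show "0 \<le> \<epsilon> * C * (\<rho> + M)" using \<epsilon>(1) C_ge(1) \<rho> \<open>0 \<le> M\<close> by simp
      fix s m assume s: "s \<in> {0..t}" and m: "\<And>r. r \<in> {0..s} \<Longrightarrow> ?e r \<le> m"
      have "0 \<le> m" using order_trans[OF norm_ge_zero m[of s]] s by simp
      have "norm ((u s - \<epsilon> *\<^sub>R (D *v p s)) + - U s) \<le>
          norm (u\<^sub>0 - \<epsilon> *\<^sub>R (D *v p\<^sub>0) + - u\<^sub>0) + integral {0..s} (\<lambda>r. L * ?e r)"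
      proof (rule caratheodory_norm_le[OF diff _ s])
        show "(\<lambda>r. L * ?e r) integrable_on {0..t}"
          by (intro integrable_continuous_real continuous_intros cont)
        show "norm (f (\<alpha> r, \<beta> r) (u r) + - f (\<alpha> r, \<beta> r) (U r)) \<le> L * ?e r" if "r \<in> {0..t}" for r
          using L(2)[OF _ u_le[OF that] U_le[OF that], of "(\<alpha> r, \<beta> r)"] in_A[OF that] in_B[OF that] by simp
      qed
      moreover have "norm (u\<^sub>0 - \<epsilon> *\<^sub>R (D *v p\<^sub>0) + - u\<^sub>0) \<le> \<epsilon> * C * \<rho>"
        using Dp[OF init(4)] by simp
      moreover have "norm (\<epsilon> *\<^sub>R (D *v p s)) \<le> \<epsilon> * C * M"
        using Dp[OF p_le[OF s]] .
      moreover have "?e s \<le> norm ((u s - \<epsilon> *\<^sub>R (D *v p s)) + - U s) + norm (\<epsilon> *\<^sub>R (D *v p s))"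
        using norm_triangle_ineq[of "(u s - \<epsilon> *\<^sub>R (D *v p s)) + - U s" "\<epsilon> *\<^sub>R (D *v p s)"]
        by (simp add: algebra_simps)
      ultimately have "?e s \<le> \<epsilon> * C * \<rho> + \<epsilon> * C * M + L * integral {0..s} ?e"
        by simp
      then show "?e s \<le> \<epsilon> * C * (\<rho> + M) + m / 4 + L * integral {0..s} ?e"
        using \<open>0 \<le> m\<close> unfolding distrib_left by linarith
    qed auto
    also have "\<dots> \<le> 2 * (\<epsilon> * C * (\<rho> + M)) * exp (4 * L)"
      using \<epsilon>(1) C_ge(1) \<rho> \<open>0 \<le> M\<close> \<open>t \<le> 1\<close> L(1) by (intro mult_left_mono) (auto simp: mult_left_le)
    also have "\<dots> = \<epsilon> * \<kappa>" by (simp add: \<kappa>_def)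
    finally show "?e s < \<delta>" using \<epsilon>\<delta> by simp
  qed
qed

section \<open>Global existence for both systems\<close>

lemma limit_solution_exists:
  fixes D :: "real^'m^'m"
    and F0 :: "real^'m \<Rightarrow> real^'m"
    and H :: "real^'m \<Rightarrow> real^'i^'m" and G :: "real^'m \<Rightarrow> real^'j^'m"
  assumes bounded: "bounded \<Omega>\<^sub>A" "bounded \<Omega>\<^sub>B"
    and F0: "locally_lipschitz F0" "linear_growth F0"
    and H: "locally_lipschitz H" "linear_growth H"
    and G: "locally_lipschitz G" "linear_growth G"
    and adm: "admissible_control t \<Omega>\<^sub>A \<alpha>" "admissible_control t \<Omega>\<^sub>B \<beta>" and "0 \<le> t"
  obtains u where "limit_solution D F0 H G t \<alpha> \<beta> u\<^sub>0 u"
proof -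
  have bdd: "bounded (fst ` (\<Omega>\<^sub>A \<times> \<Omega>\<^sub>B))" "bounded (snd ` (\<Omega>\<^sub>A \<times> \<Omega>\<^sub>B))"
    using bounded by (auto intro: bounded_subset)
  have "control_field (\<Omega>\<^sub>A \<times> \<Omega>\<^sub>B) (\<lambda>c x. H x *v fst c - D *v (F0 x + G x *v snd c))"
    using bdd by (intro control_field_diff control_field_compose_linear[OF _ matrix_vector_mul_bounded_linear]
        control_field_add control_field_state control_field_mult F0 G H) (auto intro: continuous_intros)
  moreover have "admissible_control t (\<Omega>\<^sub>A \<times> \<Omega>\<^sub>B) (\<lambda>s. (\<alpha> s, \<beta> s))"
    using adm by (auto simp: admissible_control_def intro: borel_measurable_Pair)
  ultimately have "\<exists>u. caratheodory t u (\<lambda>s. H (u s) *v fst (\<alpha> s, \<beta> s) -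
      D *v (F0 (u s) + G (u s) *v snd (\<alpha> s, \<beta> s))) u\<^sub>0"
    using \<open>0 \<le> t\<close> by (rule control_field_exists)
  then show thesis
    using that by (auto simp: limit_solution_def)
qed

text \<open>The five equations form one field on the product space, driven by the triple of
  controls. Its constants depend on \<epsilon>, so only existence is drawn from this view; uniform
  bounds come from \<open>three_scale_bound\<close>.\<close>

lemma three_scale_solution_exists:
  fixes D :: "real^'m^'m" and a b :: real
    and F0 F1 :: "real^'m \<Rightarrow> real^'m"
    and H :: "real^'m \<Rightarrow> real^'i^'m" and G :: "real^'m \<Rightarrow> real^'j^'m" and K :: "real^'m \<Rightarrow> real^'k^'m"
  assumes bounded: "bounded \<Omega>\<^sub>A" "bounded \<Omega>\<^sub>B" "bounded \<Omega>\<^sub>\<Gamma>"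
    and F0: "locally_lipschitz F0" "linear_growth F0"
    and F1: "locally_lipschitz F1" "linear_growth F1"
    and H: "locally_lipschitz H" "linear_growth H"
    and G: "locally_lipschitz G" "linear_growth G"
    and K: "locally_lipschitz K" "linear_growth K"
    and adm: "admissible_control t \<Omega>\<^sub>A \<alpha>" "admissible_control t \<Omega>\<^sub>B \<beta>" "admissible_control t \<Omega>\<^sub>\<Gamma> \<gamma>"
    and "0 \<le> t"
  obtains u v w p q where "three_scale_solution D a b F0 F1 H G K \<epsilon> t \<alpha> \<beta> \<gamma> z\<^sub>0 u v w p q"
proof -
  let ?\<Omega> = "\<Omega>\<^sub>A \<times> \<Omega>\<^sub>B \<times> \<Omega>\<^sub>\<Gamma>"
  have bdd: "bounded (fst ` ?\<Omega>)" "bounded ((\<lambda>c. fst (snd c)) ` ?\<Omega>)" "bounded ((\<lambda>c. snd (snd c)) ` ?\<Omega>)"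
    by (rule bounded_subset[OF bounded(1)] bounded_subset[OF bounded(2)] bounded_subset[OF bounded(3)]; auto)+
  let ?u = "\<lambda>z :: (real^'m) \<times> (real^'m) \<times> (real^'m) \<times> (real^'m) \<times> (real^'m). fst z"
  let ?v = "\<lambda>z :: (real^'m) \<times> (real^'m) \<times> (real^'m) \<times> (real^'m) \<times> (real^'m). fst (snd z)"
  let ?w = "\<lambda>z :: (real^'m) \<times> (real^'m) \<times> (real^'m) \<times> (real^'m) \<times> (real^'m). fst (snd (snd z))"
  let ?p = "\<lambda>z :: (real^'m) \<times> (real^'m) \<times> (real^'m) \<times> (real^'m) \<times> (real^'m). fst (snd (snd (snd z)))"
  let ?q = "\<lambda>z :: (real^'m) \<times> (real^'m) \<times> (real^'m) \<times> (real^'m) \<times> (real^'m). snd (snd (snd (snd z)))"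
  have lin: "bounded_linear ?u" "bounded_linear ?v" "bounded_linear ?w" "bounded_linear ?p" "bounded_linear ?q"
    by (intro bounded_linear_fst bounded_linear_snd bounded_linear_fst_comp bounded_linear_snd_comp)+
  define f where "f c z =
    (- (D *v ?v z) - D *v ?p z + H (?u z) *v fst c,
     - (a *\<^sub>R (D *v ?u z)) + ?w z + ?q z,
     - (b *\<^sub>R (D *v ?u z)),
     - ((1 / \<epsilon>) *\<^sub>R (?v z - F0 (?u z) - G (?u z) *v fst (snd c) + ?p z)),
     - ((1 / \<epsilon>\<^sup>2) *\<^sub>R (?w z - F1 (?u z) - K (?u z) *v snd (snd c) + ?q z)))" for c z
  have D: "control_field ?\<Omega> (\<lambda>c z. D *v k z)" if "bounded_linear k"
    for k :: "(real^'m) \<times> (real^'m) \<times> (real^'m) \<times> (real^'m) \<times> (real^'m) \<Rightarrow> real^'m"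
    using control_field_compose_linear[OF control_field_linear[OF that] matrix_vector_mul_bounded_linear] .
  have minus: "control_field ?\<Omega> (\<lambda>c z. - g c z)" if "control_field ?\<Omega> g"
    for g :: "_ \<Rightarrow> (real^'m) \<times> (real^'m) \<times> (real^'m) \<times> (real^'m) \<times> (real^'m) \<Rightarrow> real^'m"
    using control_field_compose_linear[OF that bounded_linear_minus[OF bounded_linear_ident]] .
  have scaleR: "control_field ?\<Omega> (\<lambda>c z. r *\<^sub>R g c z)" if "control_field ?\<Omega> g"
    for g :: "_ \<Rightarrow> (real^'m) \<times> (real^'m) \<times> (real^'m) \<times> (real^'m) \<times> (real^'m) \<Rightarrow> real^'m" and r
    using control_field_compose_linear[OF that bounded_linear_scaleR_right] .
  have mult: "control_field ?\<Omega> (\<lambda>c z. H (?u z) *v fst c)"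
    "control_field ?\<Omega> (\<lambda>c z. G (?u z) *v fst (snd c))"
    "control_field ?\<Omega> (\<lambda>c z. K (?u z) *v snd (snd c))"
    by (intro control_field_linear_state[OF control_field_mult lin(1)] H G K bdd continuous_intros)+
  have "control_field ?\<Omega> f"
    unfolding f_def
    by (intro control_field_Pair control_field_add control_field_diff minus scaleR D mult
        control_field_linear lin
        control_field_linear_state[OF control_field_state[OF F0] lin(1)]
        control_field_linear_state[OF control_field_state[OF F1] lin(1)])
  moreover have "admissible_control t ?\<Omega> (\<lambda>s. (\<alpha> s, \<beta> s, \<gamma> s))"
    using adm by (auto simp: admissible_control_def intro!: borel_measurable_Pair)
  ultimately have "\<exists>z. caratheodory t z (\<lambda>s. f (\<alpha> s, \<beta> s, \<gamma> s) (z s)) z\<^sub>0"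
    using \<open>0 \<le> t\<close> by (rule control_field_exists)
  then obtain z where z: "caratheodory t z (\<lambda>s. f (\<alpha> s, \<beta> s, \<gamma> s) (z s)) z\<^sub>0" by blast
  obtain u\<^sub>0 v\<^sub>0 w\<^sub>0 p\<^sub>0 q\<^sub>0 where z0: "z\<^sub>0 = (u\<^sub>0, v\<^sub>0, w\<^sub>0, p\<^sub>0, q\<^sub>0)"
    by (metis surj_pair)
  have "three_scale_solution D a b F0 F1 H G K \<epsilon> t \<alpha> \<beta> \<gamma> z\<^sub>0 (\<lambda>s. ?u (z s)) (\<lambda>s. ?v (z s))
      (\<lambda>s. ?w (z s)) (\<lambda>s. ?p (z s)) (\<lambda>s. ?q (z s))"
    using lin[THEN caratheodory_bounded_linear[OF z]] unfolding f_def fst_conv snd_conv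
    by (simp add: three_scale_solution_def z0)
  then show thesis by (rule that)
qed

section \<open>Value functions\<close>

text \<open>Infima may fail to be attained, so elements are matched in both directions. Nonemptiness
  and lower bounds ensure that \<open>Inf\<close> on the reals is the genuine infimum.\<close>

lemma abs_Inf_diff_le:
  fixes S T :: "real set"
  assumes "S \<noteq> {}" "T \<noteq> {}" "bdd_below S" "bdd_below T"
    and "\<And>x. x \<in> S \<Longrightarrow> \<exists>y\<in>T. \<bar>x - y\<bar> \<le> e" "\<And>y. y \<in> T \<Longrightarrow> \<exists>x\<in>S. \<bar>x - y\<bar> \<le> e"
  shows "\<bar>Inf S - Inf T\<bar> \<le> e"
proof -
  have "Inf T - e \<le> Inf S"
  proof (rule cInf_greatest[OF \<open>S \<noteq> {}\<close>])
    fix x assume "x \<in> S"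
    then obtain y where "y \<in> T" "\<bar>x - y\<bar> \<le> e" using assms(5) by blast
    then show "Inf T - e \<le> x" using cInf_lower[OF \<open>y \<in> T\<close> \<open>bdd_below T\<close>] by linarith
  qed
  moreover have "Inf S - e \<le> Inf T"
  proof (rule cInf_greatest[OF \<open>T \<noteq> {}\<close>])
    fix y assume "y \<in> T"
    then obtain x where "x \<in> S" "\<bar>x - y\<bar> \<le> e" using assms(6) by blast
    then show "Inf S - e \<le> y" using cInf_lower[OF \<open>x \<in> S\<close> \<open>bdd_below S\<close>] by linarith
  qed
  ultimately show ?thesis by linarith
qed

lemma cost_ge:
  assumes "\<And>x. \<bar>l x\<bar> \<le> M" "\<And>x. \<bar>\<phi> x\<bar> \<le> M" "continuous_on {0..t} (\<lambda>s. l (u s))" "0 \<le> t" "t \<le> 1"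
  shows "- (2 * M) \<le> cost l \<phi> t u"
proof -
  have "0 \<le> M" using assms(1) abs_ge_zero order_trans by blast
  have "\<bar>integral {0..t} (\<lambda>s. l (u s))\<bar> \<le> M * (t - 0)"
    using integral_bound[of 0 t "\<lambda>s. l (u s)" M] assms by simp
  also have "\<dots> \<le> M" using \<open>0 \<le> M\<close> assms by (simp add: mult_left_le)
  finally show ?thesis
    using assms(2)[of "u t"] by (simp add: cost_def abs_le_iff)
qed

lemma cost_diff_le:
  assumes "continuous_on {0..t} (\<lambda>s. l (u s))" "continuous_on {0..t} (\<lambda>s. l (U s))" "0 \<le> t" "t \<le> 1"
    and l: "\<And>s. s \<in> {0..t} \<Longrightarrow> \<bar>l (u s) - l (U s)\<bar> \<le> \<eta>" and "\<bar>\<phi> (u t) - \<phi> (U t)\<bar> \<le> \<eta>"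
  shows "\<bar>cost l \<phi> t u - cost l \<phi> t U\<bar> \<le> 2 * \<eta>"
proof -
  have "0 \<le> \<eta>" using assms(6) by linarith
  have "integral {0..t} (\<lambda>s. l (u s)) - integral {0..t} (\<lambda>s. l (U s)) = integral {0..t} (\<lambda>s. l (u s) - l (U s))"
    using assms by (intro integral_diff[symmetric] integrable_continuous_real)
  moreover have "\<bar>integral {0..t} (\<lambda>s. l (u s) - l (U s))\<bar> \<le> \<eta> * (t - 0)"
    using integral_bound[of 0 t "\<lambda>s. l (u s) - l (U s)" \<eta>] assms by (simp add: continuous_on_diff)
  moreover have "\<eta> * (t - 0) \<le> \<eta>" using \<open>0 \<le> \<eta>\<close> assms by (simp add: mult_left_le)
  ultimately show ?thesis
    using assms(6) by (simp add: cost_def)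
qed

lemma admissible_control_exists:
  assumes "\<Omega> \<noteq> {}"
  shows "\<exists>\<alpha>. admissible_control t \<Omega> \<alpha>"
proof -
  obtain c where "c \<in> \<Omega>" using assms by blast
  then have "admissible_control t \<Omega> (\<lambda>_. c)"
    by (simp add: admissible_control_def)
  then show ?thesis by blast
qed

lemma uniformly_continuous_normE:
  fixes f :: "'a::real_normed_vector \<Rightarrow> real"
  assumes "uniformly_continuous_on UNIV f" "0 < e"
  obtains d where "0 < d" "\<And>x y. norm (x - y) < d \<Longrightarrow> \<bar>f x - f y\<bar> < e"
proof -
  obtain d where "0 < d" "\<forall>x\<in>UNIV. \<forall>y\<in>UNIV. dist y x < d \<longrightarrow> dist (f y) (f x) < e"
    using assms unfolding uniformly_continuous_on_def by blast
  then show thesis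
    by (intro that[of d]) (auto simp: dist_norm)
qed

theorem corollary5p2:
  fixes D :: "real^'m^'m" and a b :: real
    and F0 F1 :: "real^'m \<Rightarrow> real^'m"
    and H :: "real^'m \<Rightarrow> real^'i^'m" and G :: "real^'m \<Rightarrow> real^'j^'m" and K :: "real^'m \<Rightarrow> real^'k^'m"
    and \<Omega>\<^sub>A :: "(real^'i) set" and \<Omega>\<^sub>B :: "(real^'j) set" and \<Omega>\<^sub>\<Gamma> :: "(real^'k) set"
    and l \<phi> :: "real^'m \<Rightarrow> real"
  assumes "a > 0" and "b > 0"
    and "compact \<Omega>\<^sub>A" and "convex \<Omega>\<^sub>A" and "\<Omega>\<^sub>A \<noteq> {}"
    and "compact \<Omega>\<^sub>B" and "convex \<Omega>\<^sub>B" and "\<Omega>\<^sub>B \<noteq> {}"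
    and "compact \<Omega>\<^sub>\<Gamma>" and "convex \<Omega>\<^sub>\<Gamma>" and "\<Omega>\<^sub>\<Gamma> \<noteq> {}"
    and "locally_lipschitz F0" and "linear_growth F0"
    and "locally_lipschitz F1" and "linear_growth F1"
    and "locally_lipschitz H" and "linear_growth H"
    and "locally_lipschitz G" and "linear_growth G"
    and "locally_lipschitz K" and "linear_growth K"
    and "\<And>x. full_rank (G x)" and "\<And>x. full_rank (K x)"
    and "bounded (range l)" and "uniformly_continuous_on UNIV l"
    and "bounded (range \<phi>)" and "uniformly_continuous_on UNIV \<phi>"
  shows "\<forall>C. compact C \<and> C \<subseteq> UNIV \<times> {0<..1} \<longrightarrow>
    uniform_limit C
      (\<lambda>\<epsilon> (z\<^sub>0, t). three_scale_value D a b F0 F1 H G K \<Omega>\<^sub>A \<Omega>\<^sub>B \<Omega>\<^sub>\<Gamma> l \<phi> \<epsilon> z\<^sub>0 t)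
      (\<lambda>((u\<^sub>0, v\<^sub>0, w\<^sub>0, p\<^sub>0, q\<^sub>0), t). limit_value D F0 H G \<Omega>\<^sub>A \<Omega>\<^sub>B l \<phi> u\<^sub>0 t)
      (at_right 0)"
proof (intro allI impI, elim conjE)
  fix C :: "(((real^'m) \<times> (real^'m) \<times> (real^'m) \<times> (real^'m) \<times> (real^'m)) \<times> real) set"
  assume "compact C" and C: "C \<subseteq> UNIV \<times> {0<..1}"
  note bdd = compact_imp_bounded[OF \<open>compact \<Omega>\<^sub>A\<close>] compact_imp_bounded[OF \<open>compact \<Omega>\<^sub>B\<close>]
    compact_imp_bounded[OF \<open>compact \<Omega>\<^sub>\<Gamma>\<close>]
  obtain \<rho> where \<rho>: "0 < \<rho>" "\<And>z. z \<in> C \<Longrightarrow> norm z \<le> \<rho>"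
    using compact_imp_bounded[OF \<open>compact C\<close>] unfolding bounded_pos by blast
  obtain M\<^sub>l where Ml: "\<And>x. \<bar>l x\<bar> \<le> M\<^sub>l"
    using \<open>bounded (range l)\<close> unfolding bounded_iff by auto
  obtain M\<^sub>\<phi> where M\<phi>: "\<And>x. \<bar>\<phi> x\<bar> \<le> M\<^sub>\<phi>"
    using \<open>bounded (range \<phi>)\<close> unfolding bounded_iff by auto
  define M where "M = max M\<^sub>l M\<^sub>\<phi>"
  have M: "\<bar>l x\<bar> \<le> M" "\<bar>\<phi> x\<bar> \<le> M" for x
    using Ml[of x] M\<phi>[of x] by (auto simp: M_def)
  have cont_l: "continuous_on {0..t} (\<lambda>s. l (x s))" if "caratheodory t x g x\<^sub>0" for t x g x\<^sub>0
    using uniformly_continuous_imp_continuous[OF \<open>uniformly_continuous_on UNIV l\<close>]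
    by (rule continuous_on_compose2[OF _ caratheodory_continuous[OF that]]) auto
  show "uniform_limit C
      (\<lambda>\<epsilon> (z\<^sub>0, t). three_scale_value D a b F0 F1 H G K \<Omega>\<^sub>A \<Omega>\<^sub>B \<Omega>\<^sub>\<Gamma> l \<phi> \<epsilon> z\<^sub>0 t)
      (\<lambda>((u\<^sub>0, v\<^sub>0, w\<^sub>0, p\<^sub>0, q\<^sub>0), t). limit_value D F0 H G \<Omega>\<^sub>A \<Omega>\<^sub>B l \<phi> u\<^sub>0 t)
      (at_right 0)"
  proof (rule uniform_limitI)
    fix e :: real assume "0 < e"
    \<comment> \<open>Running and terminal cost each change by at most \<open>e / 4\<close>. Infima
      preserve only weak inequalities, and the total \<open>e / 2\<close> leaves room for the strict
      one.\<close>
    have "0 < e / 4" using \<open>0 < e\<close> by simp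
    obtain \<delta>1 where \<delta>1: "\<delta>1 > 0" "\<And>x y. norm (x - y) < \<delta>1 \<Longrightarrow> \<bar>l x - l y\<bar> < e / 4"
      using uniformly_continuous_normE[OF \<open>uniformly_continuous_on UNIV l\<close> \<open>0 < e / 4\<close>] by blast
    obtain \<delta>2 where \<delta>2: "\<delta>2 > 0" "\<And>x y. norm (x - y) < \<delta>2 \<Longrightarrow> \<bar>\<phi> x - \<phi> y\<bar> < e / 4"
      using uniformly_continuous_normE[OF \<open>uniformly_continuous_on UNIV \<phi>\<close> \<open>0 < e / 4\<close>] by blast
    have \<delta>: "0 < min \<delta>1 \<delta>2" using \<delta>1(1) \<delta>2(1) by simp
    \<comment> \<open>One threshold for all points of \<open>C\<close> and all controls: it depends
      on \<open>C\<close> only through \<rho>. This is the uniformity of the limit.\<close>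
    obtain \<epsilon>\<^sub>0 where "0 < \<epsilon>\<^sub>0" and close:
      "\<And>\<epsilon> t \<alpha> \<beta> \<gamma> u\<^sub>0 v\<^sub>0 w\<^sub>0 p\<^sub>0 q\<^sub>0 u v w p q U s.
        0 < \<epsilon> \<Longrightarrow> \<epsilon> < \<epsilon>\<^sub>0 \<Longrightarrow> t \<le> 1 \<Longrightarrow>
        admissible_control t \<Omega>\<^sub>A \<alpha> \<Longrightarrow> admissible_control t \<Omega>\<^sub>B \<beta> \<Longrightarrow> admissible_control t \<Omega>\<^sub>\<Gamma> \<gamma> \<Longrightarrow>
        norm u\<^sub>0 \<le> \<rho> \<Longrightarrow> norm v\<^sub>0 \<le> \<rho> \<Longrightarrow> norm w\<^sub>0 \<le> \<rho> \<Longrightarrow> norm p\<^sub>0 \<le> \<rho> \<Longrightarrow> norm q\<^sub>0 \<le> \<rho> \<Longrightarrow>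
        three_scale_solution D a b F0 F1 H G K \<epsilon> t \<alpha> \<beta> \<gamma> (u\<^sub>0, v\<^sub>0, w\<^sub>0, p\<^sub>0, q\<^sub>0) u v w p q \<Longrightarrow>
        limit_solution D F0 H G t \<alpha> \<beta> u\<^sub>0 U \<Longrightarrow> s \<in> {0..t} \<Longrightarrow> norm (u s - U s) < min \<delta>1 \<delta>2"
      by (rule three_scale_comparison[OF bdd assms(12-21) less_imp_le[OF \<rho>(1)] \<delta>,
            where D = D and a = a and b = b]) (rule that, assumption+)
    have "\<bar>three_scale_value D a b F0 F1 H G K \<Omega>\<^sub>A \<Omega>\<^sub>B \<Omega>\<^sub>\<Gamma> l \<phi> \<epsilon> (u\<^sub>0, v\<^sub>0, w\<^sub>0, p\<^sub>0, q\<^sub>0) t -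
        limit_value D F0 H G \<Omega>\<^sub>A \<Omega>\<^sub>B l \<phi> u\<^sub>0 t\<bar> \<le> 2 * (e / 4)"
      if \<epsilon>: "0 < \<epsilon>" "\<epsilon> < \<epsilon>\<^sub>0" and in_C: "((u\<^sub>0, v\<^sub>0, w\<^sub>0, p\<^sub>0, q\<^sub>0), t) \<in> C" for \<epsilon> u\<^sub>0 v\<^sub>0 w\<^sub>0 p\<^sub>0 q\<^sub>0 t
    proof -
      let ?z = "(u\<^sub>0, v\<^sub>0, w\<^sub>0, p\<^sub>0, q\<^sub>0)"
      have t: "0 \<le> t" "t \<le> 1" using in_C C by auto
      have z: "norm ?z \<le> \<rho>"
        using norm_fst_le[of ?z t] \<rho>(2)[OF in_C] by (rule order_trans)
      have init: "norm u\<^sub>0 \<le> \<rho>" "norm v\<^sub>0 \<le> \<rho>" "norm w\<^sub>0 \<le> \<rho>" "norm p\<^sub>0 \<le> \<rho>" "norm q\<^sub>0 \<le> \<rho>"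
        using z norm_fst_le[of u\<^sub>0 "(v\<^sub>0, w\<^sub>0, p\<^sub>0, q\<^sub>0)"] norm_snd_le[of "(v\<^sub>0, w\<^sub>0, p\<^sub>0, q\<^sub>0)" u\<^sub>0]
          norm_fst_le[of v\<^sub>0 "(w\<^sub>0, p\<^sub>0, q\<^sub>0)"] norm_snd_le[of "(w\<^sub>0, p\<^sub>0, q\<^sub>0)" v\<^sub>0]
          norm_fst_le[of w\<^sub>0 "(p\<^sub>0, q\<^sub>0)"] norm_snd_le[of "(p\<^sub>0, q\<^sub>0)" w\<^sub>0]
          norm_fst_le[of p\<^sub>0 q\<^sub>0] norm_snd_le[of q\<^sub>0 p\<^sub>0] by linarith+
      let ?sol = "three_scale_solution D a b F0 F1 H G K \<epsilon> t"
      let ?lim = "limit_solution D F0 H G t"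
      have cont_u: "continuous_on {0..t} (\<lambda>s. l (u s))" if "?sol \<alpha> \<beta> \<gamma> ?z u v w p q" for \<alpha> \<beta> \<gamma> u v w p q
        using that by (auto simp: three_scale_solution_def intro: cont_l)
      have cont_U: "continuous_on {0..t} (\<lambda>s. l (U s))" if "?lim \<alpha> \<beta> u\<^sub>0 U" for \<alpha> \<beta> U
        using that by (auto simp: limit_solution_def intro: cont_l)
      have cost: "\<bar>cost l \<phi> t u - cost l \<phi> t U\<bar> \<le> 2 * (e / 4)"
        if adm: "admissible_control t \<Omega>\<^sub>A \<alpha>" "admissible_control t \<Omega>\<^sub>B \<beta>" "admissible_control t \<Omega>\<^sub>\<Gamma> \<gamma>"
          and sol: "?sol \<alpha> \<beta> \<gamma> ?z u v w p q" and lim: "?lim \<alpha> \<beta> u\<^sub>0 U" for \<alpha> \<beta> \<gamma> u v w p q U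
      proof -
        have "norm (u s - U s) < min \<delta>1 \<delta>2" if "s \<in> {0..t}" for s
          using close[OF \<epsilon> t(2) adm init sol lim that] .
        then show ?thesis
          using cont_u[OF sol] cont_U[OF lim] t \<delta>1(2) \<delta>2(2)
          by (intro cost_diff_le) (auto intro: less_imp_le)
      qed
      let ?S = "{cost l \<phi> t u | \<alpha> \<beta> \<gamma> u v w p q.
         admissible_control t \<Omega>\<^sub>A \<alpha> \<and> admissible_control t \<Omega>\<^sub>B \<beta> \<and> admissible_control t \<Omega>\<^sub>\<Gamma> \<gamma> \<and>
         ?sol \<alpha> \<beta> \<gamma> ?z u v w p q}"
      let ?T = "{cost l \<phi> t u | \<alpha> \<beta> u.
         admissible_control t \<Omega>\<^sub>A \<alpha> \<and> admissible_control t \<Omega>\<^sub>B \<beta> \<and> ?lim \<alpha> \<beta> u\<^sub>0 u}"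
      have lim_exists: "\<exists>U. ?lim \<alpha> \<beta> u\<^sub>0 U"
        if "admissible_control t \<Omega>\<^sub>A \<alpha>" "admissible_control t \<Omega>\<^sub>B \<beta>" for \<alpha> \<beta>
        by (rule limit_solution_exists[OF bdd(1,2) assms(12,13,16-19) that t(1),
              where D = D and u\<^sub>0 = u\<^sub>0]) blast
      have sol_exists: "\<exists>u v w p q. ?sol \<alpha> \<beta> \<gamma> ?z u v w p q"
        if "admissible_control t \<Omega>\<^sub>A \<alpha>" "admissible_control t \<Omega>\<^sub>B \<beta>" "admissible_control t \<Omega>\<^sub>\<Gamma> \<gamma>" for \<alpha> \<beta> \<gamma>
        by (rule three_scale_solution_exists[OF bdd assms(12-21) that t(1),
              where D = D and a = a and b = b and \<epsilon> = \<epsilon> and z\<^sub>0 = ?z]) blast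
      obtain \<alpha> \<beta> \<gamma> where adm: "admissible_control t \<Omega>\<^sub>A \<alpha>" "admissible_control t \<Omega>\<^sub>B \<beta>" "admissible_control t \<Omega>\<^sub>\<Gamma> \<gamma>"
        using admissible_control_exists[OF \<open>\<Omega>\<^sub>A \<noteq> {}\<close>] admissible_control_exists[OF \<open>\<Omega>\<^sub>B \<noteq> {}\<close>]
          admissible_control_exists[OF \<open>\<Omega>\<^sub>\<Gamma> \<noteq> {}\<close>] by blast
      have "\<bar>Inf ?S - Inf ?T\<bar> \<le> 2 * (e / 4)"
      proof (rule abs_Inf_diff_le)
        show "?S \<noteq> {}" using sol_exists[OF adm] adm by blast
        show "?T \<noteq> {}" using lim_exists[OF adm(1,2)] adm by blast
        show "bdd_below ?S"
          by (rule bdd_belowI[of _ "- (2 * M)"]) (auto intro!: cost_ge M t intro: cont_u)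
        show "bdd_below ?T"
          by (rule bdd_belowI[of _ "- (2 * M)"]) (auto intro!: cost_ge M t intro: cont_U)
        show "\<exists>y\<in>?T. \<bar>x - y\<bar> \<le> 2 * (e / 4)" if "x \<in> ?S" for x
        proof -
          from that obtain \<alpha> \<beta> \<gamma> u v w p q where x: "x = cost l \<phi> t u"
            and adm: "admissible_control t \<Omega>\<^sub>A \<alpha>" "admissible_control t \<Omega>\<^sub>B \<beta>" "admissible_control t \<Omega>\<^sub>\<Gamma> \<gamma>"
            and sol: "?sol \<alpha> \<beta> \<gamma> ?z u v w p q"
            by blast
          obtain U where "?lim \<alpha> \<beta> u\<^sub>0 U" using lim_exists[OF adm(1,2)] by blast
          then show ?thesis using cost[OF adm sol] adm x by blast
        qed
        show "\<exists>x\<in>?S. \<bar>x - y\<bar> \<le> 2 * (e / 4)" if "y \<in> ?T" for y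
        proof -
          from that obtain \<alpha> \<beta> U where y: "y = cost l \<phi> t U"
            and adm': "admissible_control t \<Omega>\<^sub>A \<alpha>" "admissible_control t \<Omega>\<^sub>B \<beta>"
            and lim: "?lim \<alpha> \<beta> u\<^sub>0 U"
            by blast
          \<comment> \<open>A limit trajectory carries no third control; the admissible \<gamma>
            fixed earlier completes the triple.\<close>
          obtain u v w p q where "?sol \<alpha> \<beta> \<gamma> ?z u v w p q" using sol_exists[OF adm' adm(3)] by blast
          then show ?thesis using cost[OF adm' adm(3) _ lim] adm' adm(3) y by blast
        qed
      qed
      then show ?thesis
        by (simp add: three_scale_value_def limit_value_def)
    qed note main = this
    show "\<forall>\<^sub>F \<epsilon> in at_right 0. \<forall>x\<in>C.
      dist (case x of (z\<^sub>0, t) \<Rightarrow> three_scale_value D a b F0 F1 H G K \<Omega>\<^sub>A \<Omega>\<^sub>B \<Omega>\<^sub>\<Gamma> l \<phi> \<epsilon> z\<^sub>0 t)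
        ((\<lambda>((u\<^sub>0, v\<^sub>0, w\<^sub>0, p\<^sub>0, q\<^sub>0), t). limit_value D F0 H G \<Omega>\<^sub>A \<Omega>\<^sub>B l \<phi> u\<^sub>0 t) x) < e"
      unfolding eventually_at_right_field
    proof (intro exI[of _ \<epsilon>\<^sub>0] conjI allI impI ballI \<open>0 < \<epsilon>\<^sub>0\<close>)
      fix \<epsilon> x assume "0 < \<epsilon>" "\<epsilon> < \<epsilon>\<^sub>0" "x \<in> C"
      moreover obtain u\<^sub>0 v\<^sub>0 w\<^sub>0 p\<^sub>0 q\<^sub>0 t where "x = ((u\<^sub>0, v\<^sub>0, w\<^sub>0, p\<^sub>0, q\<^sub>0), t)"
        by (metis surj_pair)
      ultimately show "dist (case x of (z\<^sub>0, t) \<Rightarrow> three_scale_value D a b F0 F1 H G K \<Omega>\<^sub>A \<Omega>\<^sub>B \<Omega>\<^sub>\<Gamma> l \<phi> \<epsilon> z\<^sub>0 t)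
        ((\<lambda>((u\<^sub>0, v\<^sub>0, w\<^sub>0, p\<^sub>0, q\<^sub>0), t). limit_value D F0 H G \<Omega>\<^sub>A \<Omega>\<^sub>B l \<phi> u\<^sub>0 t) x) < e"
        using main[of \<epsilon> u\<^sub>0 v\<^sub>0 w\<^sub>0 p\<^sub>0 q\<^sub>0 t] \<open>0 < e\<close> by (simp add: dist_real_def)
    qed
  qed
qed

end
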